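(* Let $X_1,X_2,\dots$ be i.i.d. $\mathbb{Z}$-valued random variables on a probability space $(\Omega,\mathcal{F},P)$ satisfying conditions (A1), (A2), (A3) below, and let $\beta\in(0,2]$, $c_*>0$, $\varepsilon>0$ be the constants in (A3). For each $N\in\mathbb{N}$, let $\mathcal{R}^{(N)}_n$ and $\mathbb{P}^{(N)}_{\mathcal{R}}$ be as described in the context. (I) If $\beta\in(0,1)$, then there is a constant $c_1>0$ such that for every $N\in\mathbb{N}\setminus\{1\}$ and all $y_1,\dots,y_N\in\mathbb{Z}$ with $|y_n-y_{n+1}|\le 1$ for $n=1,\dots,N-1$, $$c_1\le \mathbb{P}^{(N)}_{\mathcal{R}}\Big(\bigcup_{n=1}^N\{\mathcal{R}^{(N)}_n=(y_n \bmod N)\}\Big).$$ (II) If $\beta=1$, then there are constants $c_2>0$, $c_3>0$ such that for every $N\in\mathbb{N}\setminus\{1\}$ and all $y_1,\dots,y_N\in\mathbb{Z}$ with $|y_n-y_{n+1}|\le 1$ for $n=1,\dots,N-1$, $$\frac{1}{\frac{1}{c_*\pi}\log N+c_2}\le \mathbb{P}^{(N)}_{\mathcal{R}}\Big(\bigcup_{n=1}^N\{\mathcal{R}^{(N)}_n=(y_n \bmod N)\}\Big)\le\frac{c_3}{\log N}.$$ (III) If $\beta\in(1,2]$, then there is a constant $c_4>0$ such that for every $N\in\mathbb{N}\setminus\{1\}$ and all $y_1,\dots,y_N\in\mathbb{Z}$ with $|y_n-y_{n+1}|\le 1$ for $n=1,\dots,N-1$, $$\frac{c_4}{N^{(\beta-1)/\beta}}\le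 \mathbb{P}^{(N)}_{\mathcal{R}}\Big(\bigcup_{n=1}^N\{\mathcal{R}^{(N)}_n=(y_n \bmod N)\}\Big).$$
   Context: $S_n=\sum_{j=1}^n X_j$. For $N\in\mathbb{N}$, $V_N=\{0,1,\dots,N-1\}$ and $X^{(N)}_0$ is a random variable on a probability space $(\Omega_N,\mathcal{F}_N,\mu_N)$ uniformly distributed on $V_N$. For $b\in\mathbb{Z}$, $(b\bmod N)\in V_N$ denotes the remainder of $b$ divided by $N$. The rabbit's position is $\mathcal{R}^{(N)}_0=X^{(N)}_0$ and $\mathcal{R}^{(N)}_n=(X^{(N)}_0+S_n \bmod N)$, and $\mathbb{P}^{(N)}_{\mathcal{R}}=\mu_N\times P$ (product measure, so $X^{(N)}_0$ is independent of the walk). The characteristic function is $\phi(\theta)=\sum_{k\in\mathbb{Z}}e^{i\theta k}P\{X_1=k\}$. (A1) Strong aperiodicity: for each $y\in\mathbb{Z}$, the smallest subgroup of $\mathbb{Z}$ containing $\{y+k: P\{X_1=k\}>0\}$ is $\mathbb{Z}$. (A2) Symmetry: $P\{X_1=k\}=P\{X_1=-k\}$ for all $k\in\mathbb{Z}$. (A3) There exist $\beta\in(0,2]$, $c_*>0$ and $\varepsilon>0$ such that $\phi(\theta)=1-c_*|\theta|^\beta+O(|\theta|^{\beta+\varepsilon})$ as $\theta\to0$. The constants $c_1,\dots,c_4$ may depend on the law of $X_1$ but not on $N$ or the $y_n$. *)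

theory Defs
  imports "HOL-Probability.Probability"
begin

definition step_law :: "'a measure \<Rightarrow> (nat \<Rightarrow> 'a \<Rightarrow> int) \<Rightarrow> int \<Rightarrow> real" where
  "step_law M X k = measure M {\<omega> \<in> space M. X 1 \<omega> = k}"

definition step_charfun :: "'a measure \<Rightarrow> (nat \<Rightarrow> 'a \<Rightarrow> int) \<Rightarrow> real \<Rightarrow> complex" where
  "step_charfun M X \<theta> = (\<Sum>\<^sub>\<infinity>k\<in>(UNIV::int set). cis (\<theta> * of_int k) * complex_of_real (step_law M X k))"

definition int_subgroup :: "int set \<Rightarrow> bool" where
  "int_subgroup H \<longleftrightarrow> 0 \<in> H \<and> (\<forall>a\<in>H. \<forall>b\<in>H. a - b \<in> H)"

definition strongly_aperiodic :: "'a measure \<Rightarrow> (nat \<Rightarrow> 'a \<Rightarrow> int) \<Rightarrow> bool" where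
  "strongly_aperiodic M X \<longleftrightarrow>
     (\<forall>y::int. int_subgroup hull {y + k | k. step_law M X k > 0} = UNIV)"

definition symmetric_law :: "'a measure \<Rightarrow> (nat \<Rightarrow> 'a \<Rightarrow> int) \<Rightarrow> bool" where
  "symmetric_law M X \<longleftrightarrow> (\<forall>k. step_law M X k = step_law M X (-k))"

definition stable_expansion :: "'a measure \<Rightarrow> (nat \<Rightarrow> 'a \<Rightarrow> int) \<Rightarrow> real \<Rightarrow> real \<Rightarrow> real \<Rightarrow> bool" where
  "stable_expansion M X \<beta> cstar \<epsilon> \<longleftrightarrow>
     (\<lambda>\<theta>. step_charfun M X \<theta> - complex_of_real (1 - cstar * \<bar>\<theta>\<bar> powr \<beta>))
       \<in> O[at 0](\<lambda>\<theta>. complex_of_real (\<bar>\<theta>\<bar> powr (\<beta> + \<epsilon>)))"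

definition walk :: "(nat \<Rightarrow> 'a \<Rightarrow> int) \<Rightarrow> nat \<Rightarrow> 'a \<Rightarrow> int" where
  "walk X n \<omega> = (\<Sum>j=1..n. X j \<omega>)"

text \<open>The rabbit's position on the cycle V_N = {0,...,N-1}: the starting point x0 is the
  first coordinate, distributed uniformly on V_N, independent of the walk (product measure).\<close>
definition rabbit :: "(nat \<Rightarrow> 'a \<Rightarrow> int) \<Rightarrow> nat \<Rightarrow> nat \<Rightarrow> int \<times> 'a \<Rightarrow> int" where
  "rabbit X N n = (\<lambda>(x0, \<omega>). (x0 + walk X n \<omega>) mod int N)"

definition rabbit_measure :: "'a measure \<Rightarrow> nat \<Rightarrow> (int \<times> 'a) measure" where
  "rabbit_measure M N = uniform_count_measure {0..<int N} \<Otimes>\<^sub>M M"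

definition catch_prob :: "'a measure \<Rightarrow> (nat \<Rightarrow> 'a \<Rightarrow> int) \<Rightarrow> nat \<Rightarrow> (nat \<Rightarrow> int) \<Rightarrow> real" where
  "catch_prob M X N y = measure (rabbit_measure M N)
     (\<Union>n\<in>{1..N}. {z \<in> space (rabbit_measure M N). rabbit X N n z = y n mod int N})"

end

theory Submission
  imports Defs "HOL-Analysis.Harmonic_Numbers" "HOL-Real_Asymp.Real_Asymp"
begin

text \<open>
  Started uniformly, the rabbit sits on the target at any given time with probability
  \<open>1/N\<close>, so the expected number of hits up to time \<open>L\<close> is \<open>L/N\<close>. Splitting at the first hit, at
  time \<open>n\<close> say, the expected number of hits from then on is the Green-type sum of
  \<open>P(S\<^sub>j \<equiv> y\<^sub>n\<^sub>+\<^sub>j - y\<^sub>n mod N)\<close> over \<open>j \<le> L - n\<close>. Hence an upper bound \<open>G\<close> for these sums with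
  \<open>L = N\<close> makes the catching probability at least \<open>1/G\<close>, and a lower bound \<open>g\<close> with \<open>L = 2N\<close> and
  \<open>n \<le> N\<close> makes it at most \<open>2/g\<close>.

  By Fourier inversion on the cycle the sums are at most the average over \<open>\<theta> = 2\<pi>k/N\<close>, \<open>k < N\<close>, of
  \<open>\<Sum>\<^sub>j |\<phi>(\<theta>)|\<^sup>j \<le> min N (1/(1 - |\<phi>(\<theta>)|))\<close>, and strong aperiodicity with the expansion at \<open>0\<close>
  gives \<open>1 - |\<phi>(\<theta>)| \<ge> a |\<theta>|\<^sup>\<beta>\<close> on \<open>[-\<pi>,\<pi>]\<close>, with the sharp constant near \<open>0\<close>. For the upper bound
  with \<open>\<beta> = 1\<close>, Fourier inversion on the integers and dominated convergence give a local limit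
  theorem with Cauchy limit, so \<open>P(S\<^sub>m = z)\<close> is at least of order \<open>1/m\<close> for \<open>|z| \<le> m\<close>; along a path with
  steps of size at most \<open>1\<close> these terms sum to order \<open>log N\<close>.
\<close>

section \<open>Power sums and sums over the dual of the cycle\<close>

text \<open>The mean value theorem, with the derivative \<open>s * z powr (s - 1)\<close> decreasing
  in \<open>z\<close>. The point \<open>x = 0\<close> is treated apart because the power need not be
  differentiable there.\<close>

lemma powr_increment_ge:
  fixes s x :: real
  assumes "0 < s" "s \<le> 1" "0 \<le> x"
  shows "s * (x + 1) powr (s - 1) \<le> (x + 1) powr s - x powr s"
proof (cases "x = 0")
  case True
  then show ?thesis using assms by simp
next
  case False
  then have x: "x > 0" using assms by simp
  have "\<exists>z. z > x \<and> z < x + 1 \<and> (x + 1) powr s - x powr s = (x + 1 - x) * (s * z powr (s - 1))"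
    by (rule MVT2) (use x in \<open>auto intro!: derivative_eq_intros\<close>)
  then obtain z where z: "z > x" "z < x + 1" "(x + 1) powr s - x powr s = s * z powr (s - 1)"
    by auto
  have "(x + 1) powr (s - 1) \<le> z powr (s - 1)"
    by (rule powr_mono2') (use assms x z in auto)
  then show ?thesis using z assms by simp
qed

text \<open>Telescoping of \<open>powr_increment_ge\<close>. The exponent \<open>s - 1\<close>
  stands for \<open>- \<beta>\<close> when \<open>\<beta> < 1\<close> and for the error exponent
  when \<open>\<beta> = 1\<close>.\<close>

lemma sum_powr_le:
  fixes s :: real
  assumes "0 < s" "s \<le> 1"
  shows "(\<Sum>k=1..n. real k powr (s - 1)) \<le> real n powr s / s"
proof (induction n)
  case 0
  then show ?case by simp
next
  case (Suc n)
  have "real (Suc n) powr (s - 1) \<le> (real (Suc n) powr s - real n powr s) / s"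
    using powr_increment_ge[of s "real n"] assms by (simp add: field_simps)
  with Suc show ?case by (simp add: diff_divide_distrib)
qed

lemma powr_decrement_ge:
  fixes \<beta> x :: real
  assumes "1 < \<beta>" "0 < x"
  shows "(\<beta> - 1) * (x + 1) powr (- \<beta>) \<le> x powr (1 - \<beta>) - (x + 1) powr (1 - \<beta>)"
proof -
  have "\<exists>z. z > x \<and> z < x + 1 \<and>
      (x + 1) powr (1 - \<beta>) - x powr (1 - \<beta>) = (x + 1 - x) * ((1 - \<beta>) * z powr (- \<beta>))"
    by (rule MVT2) (use assms in \<open>auto intro!: derivative_eq_intros\<close>)
  then obtain z where z: "z > x" "z < x + 1"
      "(x + 1) powr (1 - \<beta>) - x powr (1 - \<beta>) = (1 - \<beta>) * z powr (- \<beta>)"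
    by auto
  have "(x + 1) powr (- \<beta>) \<le> z powr (- \<beta>)"
    by (rule powr_mono2') (use assms z in auto)
  then have "(\<beta> - 1) * (x + 1) powr (- \<beta>) \<le> (\<beta> - 1) * z powr (- \<beta>)"
    using assms by simp
  then show ?thesis using z by (simp add: algebra_simps)
qed

text \<open>The telescoped counterpart for summable powers, used beyond the cutoff in
  \<open>green_bound_le_powr\<close>.\<close>

lemma sum_powr_tail_le:
  fixes \<beta> :: real
  assumes "1 < \<beta>" "1 \<le> K"
  shows "(\<Sum>k=Suc K..n. real k powr (- \<beta>)) \<le> real K powr (1 - \<beta>) / (\<beta> - 1)"
proof (cases "K \<le> n")
  case True
  have "(\<Sum>k=Suc K..n. real k powr (- \<beta>)) \<le> (real K powr (1 - \<beta>) - real n powr (1 - \<beta>)) / (\<beta> - 1)"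
    using True
  proof (induction n rule: dec_induct)
    case base
    then show ?case by simp
  next
    case (step n)
    have "real (Suc n) powr (- \<beta>) \<le> (real n powr (1 - \<beta>) - real (Suc n) powr (1 - \<beta>)) / (\<beta> - 1)"
      using powr_decrement_ge[of \<beta> "real n"] assms step by (simp add: field_simps)
    with step show ?case by (simp add: diff_divide_distrib)
  qed
  also have "\<dots> \<le> real K powr (1 - \<beta>) / (\<beta> - 1)"
    using assms by (intro divide_right_mono) auto
  finally show ?thesis .
next
  case False
  then show ?thesis using assms by simp
qed

text \<open>Replacing \<open>k\<close> by \<open>N - k\<close> sends the upper half into the lower
  half. For even \<open>N\<close> the middle index is counted twice on the right, hence an
  inequality.\<close>

lemma sum_reflection_le:
  fixes h :: "nat \<Rightarrow> real"
  assumes "\<And>k. 0 \<le> h k" and "\<And>k. k \<in> {1..<N} \<Longrightarrow> h (N - k) = h k"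
  shows "(\<Sum>k\<in>{1..<N}. h k) \<le> 2 * (\<Sum>k=1..N div 2. h k)"
proof -
  let ?B = "{k\<in>{1..<N}. k \<le> N div 2}" and ?A = "{k\<in>{1..<N}. N div 2 < k}"
  have "(\<Sum>k\<in>{1..<N}. h k) = (\<Sum>k\<in>?B. h k) + (\<Sum>k\<in>?A. h k)"
    by (subst sum.union_disjoint[symmetric]) (auto intro!: sum.cong)
  also have "(\<Sum>k\<in>?A. h k) = (\<Sum>k\<in>(\<lambda>k. N - k) ` ?A. h k)"
    by (subst sum.reindex) (auto simp: inj_on_def assms intro!: sum.cong)
  also have "(\<Sum>k\<in>(\<lambda>k. N - k) ` ?A. h k) \<le> (\<Sum>k=1..N div 2. h k)"
    by (intro sum_mono2) (auto simp: assms)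
  also have "(\<Sum>k\<in>?B. h k) \<le> (\<Sum>k=1..N div 2. h k)"
    by (intro sum_mono2) (auto simp: assms)
  finally show ?thesis by simp
qed

lemma geometric_sum_le:
  fixes q :: real
  assumes "0 \<le> q" "q < 1"
  shows "(\<Sum>j<n. q ^ j) \<le> 1 / (1 - q)"
proof -
  have "(\<Sum>j<n. q ^ j) = (1 - q ^ n) / (1 - q)"
    using assms by (subst sum_gp_strict) auto
  also have "\<dots> \<le> 1 / (1 - q)"
    using assms by (intro divide_right_mono) auto
  finally show ?thesis .
qed

lemma angle_range:
  assumes "k \<in> {1..N div 2}"
  shows "0 < 2 * pi * real k / real N" "2 * pi * real k / real N \<le> pi"
proof -
  have k: "2 * real k \<le> real N" "1 \<le> k" "0 < real N" using assms by auto
  show "0 < 2 * pi * real k / real N" using k by simp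
  have "2 * pi * real k / real N = pi * (2 * real k / real N)" by simp
  also have "\<dots> \<le> pi * 1"
    using k by (intro mult_left_mono) auto
  finally show "2 * pi * real k / real N \<le> pi" by simp
qed

section \<open>Green sums averaged over the dual of the cycle\<close>

definition green_bound :: "(real \<Rightarrow> real) \<Rightarrow> nat \<Rightarrow> real" where
  "green_bound f N = (\<Sum>k<N. \<Sum>j<N. f (2 * pi * real k / real N) ^ j) / real N"

text \<open>\<open>reflect\<close> combines evenness with period \<open>2 * pi\<close>; it carries
  \<open>less_1\<close> over from the half circle.\<close>

locale circle_multiplier =
  fixes f :: "real \<Rightarrow> real"
  assumes nonneg: "0 \<le> f \<theta>" and le_1: "f \<theta> \<le> 1"
    and reflect: "f (2 * pi - \<theta>) = f \<theta>"
    and less_1: "0 < \<theta> \<Longrightarrow> \<theta> \<le> pi \<Longrightarrow> f \<theta> < 1"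
begin

text \<open>Truncating at \<open>j < N\<close> makes the frequency \<open>k = 0\<close>, where no
  gap is available, contribute at most \<open>1\<close>. The remaining frequencies fold in half by
  reflection.\<close>

lemma green_bound_le_half_sum:
  assumes "1 \<le> N"
  shows "green_bound f N \<le> 1 + 2 * (\<Sum>k=1..N div 2. \<Sum>j<N. f (2 * pi * real k / real N) ^ j) / real N"
proof -
  let ?h = "\<lambda>k. \<Sum>j<N. f (2 * pi * real k / real N) ^ j"
  have "(\<Sum>k<N. ?h k) = ?h 0 + (\<Sum>k\<in>{1..<N}. ?h k)"
    using assms by (simp add: lessThan_atLeast0 sum.atLeast_Suc_lessThan)
  also have "?h 0 \<le> (\<Sum>j<N. 1)"
    by (intro sum_mono power_le_one nonneg le_1)
  also have "(\<Sum>k\<in>{1..<N}. ?h k) \<le> 2 * (\<Sum>k=1..N div 2. ?h k)"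
  proof (rule sum_reflection_le)
    show "0 \<le> ?h k" for k by (intro sum_nonneg zero_le_power nonneg)
    fix k assume k: "k \<in> {1..<N}"
    then have "2 * pi * real (N - k) / real N = 2 * pi - 2 * pi * real k / real N"
      by (simp add: of_nat_diff field_simps)
    then show "?h (N - k) = ?h k" by (simp add: reflect)
  qed
  finally show ?thesis
    using assms by (simp add: green_bound_def field_simps)
qed

text \<open>The term \<open>a / \<theta>\<close> becomes a harmonic sum and gives
  \<open>ln N\<close> with coefficient \<open>a / pi\<close>, while the power, integrable at
  \<open>0\<close>, only adds a constant. With \<open>a = 0\<close> and
  \<open>s = 1 - \<beta>\<close> the bound is uniform in \<open>N\<close>, as needed for
  \<open>\<beta> < 1\<close>.\<close>

lemma green_bound_le_log:
  assumes N: "1 \<le> N" and s: "0 < s" "s \<le> 1" and a: "0 \<le> a" and C: "0 \<le> C"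
    and gap: "\<And>\<theta>. 0 < \<theta> \<Longrightarrow> \<theta> \<le> pi \<Longrightarrow> 1 / (1 - f \<theta>) \<le> a / \<theta> + C * \<theta> powr (s - 1)"
  shows "green_bound f N \<le> 1 + a / pi * (ln (real N) + 1) + 2 * C * (2 * pi) powr (s - 1) / s"
proof -
  let ?n = "N div 2"
  have "(\<Sum>k=1..?n. \<Sum>j<N. f (2 * pi * real k / real N) ^ j)
      \<le> (\<Sum>k=1..?n. a * real N / (2 * pi) * (1 / real k)
              + C * (2 * pi / real N) powr (s - 1) * real k powr (s - 1))"
  proof (rule sum_mono)
    fix k assume k: "k \<in> {1..?n}"
    let ?t = "2 * pi * real k / real N"
    have "(\<Sum>j<N. f ?t ^ j) \<le> 1 / (1 - f ?t)"
      by (intro geometric_sum_le nonneg less_1 angle_range[OF k])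
    also have "\<dots> \<le> a / ?t + C * ?t powr (s - 1)"
      by (intro gap angle_range[OF k])
    also have "?t powr (s - 1) = (2 * pi / real N) powr (s - 1) * real k powr (s - 1)"
      by (subst powr_mult[symmetric]) (auto simp: field_simps)
    finally show "(\<Sum>j<N. f ?t ^ j) \<le> a * real N / (2 * pi) * (1 / real k)
              + C * (2 * pi / real N) powr (s - 1) * real k powr (s - 1)"
      by (simp add: field_simps)
  qed
  also have "\<dots> = a * real N / (2 * pi) * harm ?n
      + C * (2 * pi / real N) powr (s - 1) * (\<Sum>k=1..?n. real k powr (s - 1))"
    unfolding harm_def by (simp add: sum.distrib sum_distrib_left inverse_eq_divide)
  also have "\<dots> \<le> a * real N / (2 * pi) * (ln (real N) + 1)
      + C * (2 * pi / real N) powr (s - 1) * (real N powr s / s)"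
  proof (intro add_mono mult_left_mono)
    show "harm ?n \<le> ln (real N) + 1"
    proof (cases "?n = 0")
      case True
      then show ?thesis using N by (simp add: harm_def)
    next
      case False
      have "harm ?n - ln (real ?n) \<le> harm 1 - ln (real 1)"
        by (rule euler_mascheroni_sequence_decreasing) (use False in auto)
      moreover have "ln (real ?n) \<le> ln (real N)" using False by simp
      ultimately show ?thesis by (simp add: harm_def)
    qed
    have "(\<Sum>k=1..?n. real k powr (s - 1)) \<le> real ?n powr s / s"
      by (rule sum_powr_le[OF s])
    also have "\<dots> \<le> real N powr s / s"
      using s by (intro divide_right_mono powr_mono2) auto
    finally show "(\<Sum>k=1..?n. real k powr (s - 1)) \<le> real N powr s / s" .
  qed (use a C in auto)
  \<comment> \<open>The powers of \<open>N\<close> combine to \<open>N\<close> itself, which the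
    division by \<open>N\<close> in \<open>green_bound\<close> cancels.\<close>
  also have "C * (2 * pi / real N) powr (s - 1) * (real N powr s / s) = C * (2 * pi) powr (s - 1) / s * real N"
    using N by (simp add: powr_divide powr_diff field_simps)
  finally have *: "(\<Sum>k=1..?n. \<Sum>j<N. f (2 * pi * real k / real N) ^ j)
     \<le> (a / (2 * pi) * (ln (real N) + 1) + C * (2 * pi) powr (s - 1) / s) * real N"
    by (simp add: algebra_simps)
  have "green_bound f N \<le> 1 + 2 * (\<Sum>k=1..?n. \<Sum>j<N. f (2 * pi * real k / real N) ^ j) / real N"
    by (rule green_bound_le_half_sum[OF N])
  also have "\<dots> \<le> 1 + 2 * ((a / (2 * pi) * (ln (real N) + 1) + C * (2 * pi) powr (s - 1) / s) * real N) / real N"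
    using * by (intro add_left_mono divide_right_mono mult_left_mono) auto
  also have "\<dots> = 1 + a / pi * (ln (real N) + 1) + 2 * C * (2 * pi) powr (s - 1) / s"
    using N by (simp add: field_simps)
  finally show ?thesis .
qed

text \<open>Frequencies up to a cutoff \<open>K\<close> get the trivial bound \<open>N\<close>, the
  others the geometric series. The total
  \<open>K * N + N powr \<beta> * K powr (1 - \<beta>)\<close> is balanced, up to constants, by
  \<open>K powr \<beta> = N powr (\<beta> - 1)\<close>.\<close>

lemma green_bound_le_powr:
  assumes N: "1 \<le> N" and \<beta>: "1 < \<beta>" and C: "0 \<le> C"
    and gap: "\<And>\<theta>. 0 < \<theta> \<Longrightarrow> \<theta> \<le> pi \<Longrightarrow> 1 / (1 - f \<theta>) \<le> C * \<theta> powr (- \<beta>)"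
  shows "green_bound f N
    \<le> (3 + 2 * C * (2 * pi) powr (- \<beta>) * 2 powr (\<beta> - 1) / (\<beta> - 1)) * real N powr ((\<beta> - 1) / \<beta>)"
proof -
  let ?n = "N div 2" and ?r = "real N powr ((\<beta> - 1) / \<beta>)"
  define K where "K = nat \<lfloor>?r\<rfloor>"
  have r1: "1 \<le> ?r" using N \<beta> by (intro ge_one_powr_ge_zero) auto
  have K_eq: "real K = of_int \<lfloor>?r\<rfloor>" using r1 by (simp add: K_def)
  have K: "1 \<le> K" using r1 by (simp add: K_def le_nat_iff)
  have K_le: "real K \<le> ?r" unfolding K_eq by (rule of_int_floor_le)
  \<comment> \<open>As \<open>K\<close> is at least \<open>1\<close>, rounding down loses at most a
    factor \<open>2\<close>.\<close>
  have "?r < real K + 1" unfolding K_eq by linarith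
  then have K_ge: "?r / 2 \<le> real K" using K by linarith
  define c where "c = C * (2 * pi / real N) powr (- \<beta>)"
  have c0: "0 \<le> c" using C by (simp add: c_def)
  have geo: "(\<Sum>j<N. f (2 * pi * real k / real N) ^ j) \<le> c * real k powr (- \<beta>)"
    if k: "k \<in> {1..?n}" for k
  proof -
    let ?t = "2 * pi * real k / real N"
    have "(\<Sum>j<N. f ?t ^ j) \<le> 1 / (1 - f ?t)"
      by (intro geometric_sum_le nonneg less_1 angle_range[OF k])
    also have "\<dots> \<le> C * ?t powr (- \<beta>)"
      by (intro gap angle_range[OF k])
    also have "?t powr (- \<beta>) = (2 * pi / real N) powr (- \<beta>) * real k powr (- \<beta>)"
      by (subst powr_mult[symmetric]) (auto simp: field_simps)
    finally show ?thesis by (simp add: c_def mult.assoc)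
  qed
  have one: "(\<Sum>j<N. f (2 * pi * real k / real N) ^ j) \<le> real N" for k
  proof -
    have "(\<Sum>j<N. f (2 * pi * real k / real N) ^ j) \<le> (\<Sum>j<N. 1)"
      by (intro sum_mono power_le_one nonneg le_1)
    then show ?thesis by simp
  qed
  have "(\<Sum>k=1..?n. \<Sum>j<N. f (2 * pi * real k / real N) ^ j)
     \<le> (\<Sum>k=1..?n. (if k \<le> K then real N else 0) + (if Suc K \<le> k then c * real k powr (- \<beta>) else 0))"
    using geo one by (intro sum_mono) auto
  also have "\<dots> = (\<Sum>k\<in>{k\<in>{1..?n}. k \<le> K}. real N) + (\<Sum>k\<in>{k\<in>{1..?n}. Suc K \<le> k}. c * real k powr (- \<beta>))"
    unfolding sum.distrib by (simp only: sum.inter_filter finite_atLeastAtMost)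
  also have "(\<Sum>k\<in>{k\<in>{1..?n}. k \<le> K}. real N) \<le> (\<Sum>k\<in>{1..K}. real N)"
    by (intro sum_mono2) auto
  also have "{k\<in>{1..?n}. Suc K \<le> k} = {Suc K..?n}" by auto
  also have "(\<Sum>k=Suc K..?n. c * real k powr (- \<beta>)) \<le> c * (real K powr (1 - \<beta>) / (\<beta> - 1))"
    unfolding sum_distrib_left[symmetric] by (intro mult_left_mono sum_powr_tail_le \<beta> K c0)
  \<comment> \<open>The exponent \<open>1 - \<beta>\<close> is negative, so the lower bound on
    \<open>K\<close> is the one needed here.\<close>
  also have "c * (real K powr (1 - \<beta>) / (\<beta> - 1)) \<le> c * ((?r / 2) powr (1 - \<beta>) / (\<beta> - 1))"
    using N K_ge \<beta> r1 c0 by (intro mult_left_mono divide_right_mono powr_mono2') auto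
  also have "c * ((?r / 2) powr (1 - \<beta>) / (\<beta> - 1)) =
      C * (2 * pi) powr (- \<beta>) * 2 powr (\<beta> - 1) / (\<beta> - 1) * ?r * real N"
  proof -
    have "real N powr \<beta> * ?r powr (1 - \<beta>) = real N powr (\<beta> + (\<beta> - 1) / \<beta> * (1 - \<beta>))"
      by (simp add: powr_powr powr_add)
    also have "\<beta> + (\<beta> - 1) / \<beta> * (1 - \<beta>) = (\<beta> - 1) / \<beta> + 1"
      using \<beta> by (simp add: field_simps)
    also have "real N powr \<dots> = ?r * real N" using N by (simp add: powr_add)
    finally have *: "real N powr \<beta> * ?r powr (1 - \<beta>) = ?r * real N" .
    have "c * ((?r / 2) powr (1 - \<beta>) / (\<beta> - 1)) =
       C * (2 * pi) powr (- \<beta>) * 2 powr (\<beta> - 1) / (\<beta> - 1) * (real N powr \<beta> * ?r powr (1 - \<beta>))"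
      unfolding c_def using N
      by (simp add: powr_divide powr_minus_divide powr_diff ac_simps)
    then show ?thesis unfolding * by (simp add: mult.assoc)
  qed
  finally have *: "(\<Sum>k=1..?n. \<Sum>j<N. f (2 * pi * real k / real N) ^ j)
     \<le> (real K + C * (2 * pi) powr (- \<beta>) * 2 powr (\<beta> - 1) / (\<beta> - 1) * ?r) * real N"
    by (simp add: algebra_simps)
  have "green_bound f N \<le> 1 + 2 * (\<Sum>k=1..?n. \<Sum>j<N. f (2 * pi * real k / real N) ^ j) / real N"
    by (rule green_bound_le_half_sum[OF N])
  also have "\<dots> \<le> 1 + 2 * ((real K + C * (2 * pi) powr (- \<beta>) * 2 powr (\<beta> - 1) / (\<beta> - 1) * ?r) * real N) / real N"
    using * by (intro add_left_mono divide_right_mono mult_left_mono) auto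
  also have "\<dots> = 1 + 2 * real K + 2 * C * (2 * pi) powr (- \<beta>) * 2 powr (\<beta> - 1) / (\<beta> - 1) * ?r"
    using N by (simp add: field_simps)
  also have "\<dots> \<le> ?r + 2 * ?r + 2 * C * (2 * pi) powr (- \<beta>) * 2 powr (\<beta> - 1) / (\<beta> - 1) * ?r"
    using r1 K_le by (intro add_mono mult_left_mono order_refl) simp_all
  finally show ?thesis by (simp add: algebra_simps)
qed

end

section \<open>Integer random walks\<close>

text \<open>A finite product of countable discrete spaces is discrete. This makes every event
  depending on finitely many steps measurable.\<close>

lemma sets_PiM_count_space:
  fixes A :: "('i \<Rightarrow> 'b::countable) set"
  assumes "finite I" "A \<subseteq> PiE I (\<lambda>_. UNIV)"
  shows "A \<in> sets (PiM I (\<lambda>_. count_space UNIV))"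
proof (rule sets.countable)
  show "countable A"
    by (rule countable_subset[OF assms(2)]) (intro countable_PiE assms, auto)
  fix f assume "f \<in> A"
  then have "f \<in> PiE I (\<lambda>_. UNIV)" using assms by auto
  then have "{f} = PiE I (\<lambda>i. {f i})"
    by (auto simp: PiE_singleton[symmetric] extensional_def PiE_def)
  also have "\<dots> \<in> sets (PiM I (\<lambda>_. count_space UNIV))"
    by (intro sets_PiM_I_finite assms) auto
  finally show "{f} \<in> sets (PiM I (\<lambda>_. count_space UNIV))" .
qed

locale iid_int_walk = prob_space M for M :: "'a measure" +
  fixes X :: "nat \<Rightarrow> 'a \<Rightarrow> int"
  assumes X_measurable: "i \<ge> 1 \<Longrightarrow> X i \<in> measurable M (count_space UNIV)"
    and X_indep: "indep_vars (\<lambda>_. count_space UNIV) X {1..}"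
    and X_distr: "i \<ge> 1 \<Longrightarrow> distr M (count_space UNIV) (X i) = distr M (count_space UNIV) (X 1)"
begin

lemma real_X_measurable [measurable]: "i \<ge> 1 \<Longrightarrow> (\<lambda>\<omega>. real_of_int (X i \<omega>)) \<in> borel_measurable M"
  by (rule measurable_compose[OF X_measurable]) auto

lemma sum_X_measurable: "A \<subseteq> {1..} \<Longrightarrow> (\<lambda>\<omega>. \<Sum>j\<in>A. X j \<omega>) \<in> measurable M (count_space UNIV)"
proof (induction A rule: infinite_finite_induct)
  case (insert i A)
  have "(\<lambda>\<omega>. X i \<omega> + (\<Sum>j\<in>A. X j \<omega>)) \<in> measurable M (count_space UNIV)"
    by (rule measurable_compose_countable[where f="\<lambda>k \<omega>. X i \<omega> + k" and g="\<lambda>\<omega>. \<Sum>j\<in>A. X j \<omega>"])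
       (use insert in \<open>auto intro!: measurable_compose[OF X_measurable]\<close>)
  with insert show ?case by simp
qed auto

lemma walk_measurable [measurable]: "walk X n \<in> measurable M (count_space UNIV)"
  unfolding walk_def[abs_def] by (rule sum_X_measurable) auto

lemma indep_vars_real: "indep_vars (\<lambda>_. borel) (\<lambda>i \<omega>. real_of_int (X i \<omega>)) {1..}"
  by (rule indep_vars_compose2[OF X_indep]) auto

text \<open>Taken over the reals so that multiplicativity, continuity and Levy uniqueness for
  \<open>char\<close> apply; \<open>step_char_eq_step_charfun\<close> identifies it with the series
  in (A3).\<close>

definition step_char :: "real \<Rightarrow> complex" where
  "step_char \<theta> = char (distr M borel (\<lambda>\<omega>. real_of_int (X 1 \<omega>))) \<theta>"

lemma distr_real_X:
  assumes "i \<ge> 1"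
  shows "distr M borel (\<lambda>\<omega>. real_of_int (X i \<omega>)) = distr M borel (\<lambda>\<omega>. real_of_int (X 1 \<omega>))"
proof -
  have *: "distr M borel (\<lambda>\<omega>. real_of_int (X j \<omega>)) = distr (distr M (count_space UNIV) (X j)) borel real_of_int"
    if "j \<ge> 1" for j
    using X_measurable[OF that] by (subst distr_distr) (auto simp: comp_def)
  show ?thesis unfolding *[OF assms] *[OF order_refl] X_distr[OF assms] ..
qed

lemma char_sum_X:
  assumes "A \<subseteq> {1..}" "finite A"
  shows "char (distr M borel (\<lambda>\<omega>. real_of_int (\<Sum>j\<in>A. X j \<omega>))) \<theta> = step_char \<theta> ^ card A"
proof -
  have "char (distr M borel (\<lambda>\<omega>. \<Sum>j\<in>A. real_of_int (X j \<omega>))) \<theta>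
      = (\<Prod>j\<in>A. char (distr M borel (\<lambda>\<omega>. real_of_int (X j \<omega>))) \<theta>)"
    by (rule char_distr_sum) (rule indep_vars_subset[OF indep_vars_real assms(1)])
  also have "\<dots> = (\<Prod>j\<in>A. step_char \<theta>)"
    using assms unfolding step_char_def by (intro prod.cong refl arg_cong2[where f=char] distr_real_X) auto
  finally show ?thesis by simp
qed

lemma expectation_cis_sum_X:
  assumes "A \<subseteq> {1..}" "finite A"
  shows "expectation (\<lambda>\<omega>. cis (\<theta> * of_int (\<Sum>j\<in>A. X j \<omega>))) = step_char \<theta> ^ card A"
proof -
  have [measurable]: "(\<lambda>\<omega>. real_of_int (\<Sum>j\<in>A. X j \<omega>)) \<in> borel_measurable M"
    by (rule measurable_compose[OF sum_X_measurable[OF assms(1)]]) auto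
  have "step_char \<theta> ^ card A = expectation (\<lambda>\<omega>. iexp (\<theta> * real_of_int (\<Sum>j\<in>A. X j \<omega>)))"
    unfolding char_sum_X[OF assms, symmetric] char_def by (subst integral_distr) (simp_all del: of_int_sum)
  then show ?thesis by (simp add: cis_conv_exp)
qed

lemma expectation_cis_walk: "expectation (\<lambda>\<omega>. cis (\<theta> * of_int (walk X n \<omega>))) = step_char \<theta> ^ n"
  unfolding walk_def using expectation_cis_sum_X[of "{1..n}"] by simp

text \<open>Both sums have characteristic function \<open>step_char \<theta> ^ m\<close>, so Levy
  uniqueness identifies their laws.\<close>

lemma prob_sum_X_shift:
  "prob {\<omega> \<in> space M. P (\<Sum>j=n+1..n+m. X j \<omega>)} = prob {\<omega> \<in> space M. P (walk X m \<omega>)}"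
proof -
  have 1: "distr M borel (\<lambda>\<omega>. real_of_int (\<Sum>j=n+1..n+m. X j \<omega>)) = distr M borel (\<lambda>\<omega>. real_of_int (walk X m \<omega>))"
    (is "distr M borel ?U = distr M borel ?V")
  proof (rule Levy_uniqueness)
    have [measurable]: "?U \<in> borel_measurable M" "?V \<in> borel_measurable M"
      by (rule measurable_compose[OF sum_X_measurable] measurable_compose[OF walk_measurable]; auto)+
    show "real_distribution (distr M borel ?U)" "real_distribution (distr M borel ?V)"
      by (rule real_distribution_distr; simp)+
    show "char (distr M borel ?U) = char (distr M borel ?V)"
      unfolding walk_def by (rule ext, subst (1 2) char_sum_X) auto
  qed
  \<comment> \<open>Sets of integers are closed in the reals, so an arbitrary predicate
    \<open>P\<close> is a Borel event for the real-valued law.\<close>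
  have *: "prob {\<omega> \<in> space M. P (W \<omega>)} = measure (distr M borel (\<lambda>\<omega>. real_of_int (W \<omega>))) (of_int ` {k. P k})"
    if "W \<in> measurable M (count_space UNIV)" for W :: "'a \<Rightarrow> int"
  proof -
    have "(\<lambda>\<omega>. real_of_int (W \<omega>)) \<in> borel_measurable M"
      by (rule measurable_compose[OF that]) auto
    moreover have "(of_int ` {k. P k} :: real set) \<in> sets borel"
      by (intro borel_closed closed_of_int_image)
    moreover have "(\<lambda>\<omega>. real_of_int (W \<omega>)) -` of_int ` {k. P k} \<inter> space M = {\<omega> \<in> space M. P (W \<omega>)}"
      by auto
    ultimately show ?thesis by (simp add: measure_distr)
  qed
  have "(\<lambda>\<omega>. \<Sum>j=n+1..n+m. X j \<omega>) \<in> measurable M (count_space UNIV)"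
    by (rule sum_X_measurable) auto
  from *[OF this] *[OF walk_measurable] 1 show ?thesis by simp
qed

text \<open>The Markov property at time \<open>n\<close>: disjoint blocks of steps are independent,
  and the later block is moved to the origin by \<open>prob_sum_X_shift\<close>. \<open>Q\<close>
  sees all the early steps because a first hit depends on all of them.\<close>

lemma prob_prefix_and_increment:
  "prob {\<omega> \<in> space M. Q (\<lambda>i\<in>{1..n}. X i \<omega>) \<and> R (\<Sum>j=n+1..n+m. X j \<omega>)}
   = prob {\<omega> \<in> space M. Q (\<lambda>i\<in>{1..n}. X i \<omega>)} * prob {\<omega> \<in> space M. R (walk X m \<omega>)}"
proof -
  let ?I = "{1..n}" and ?J = "{n+1..n+m}"
  let ?MI = "PiM ?I (\<lambda>_. count_space (UNIV :: int set))" and ?MJ = "PiM ?J (\<lambda>_. count_space (UNIV :: int set))"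
  let ?XI = "\<lambda>\<omega>. \<lambda>i\<in>?I. X i \<omega>" and ?XJ = "\<lambda>\<omega>. \<lambda>i\<in>?J. X i \<omega>"
  let ?A = "{f \<in> PiE ?I (\<lambda>_. UNIV). Q f}" and ?B = "{f \<in> PiE ?J (\<lambda>_. UNIV). R (\<Sum>j\<in>?J. f j)}"
  have ind: "indep_var ?MI ?XI ?MJ ?XJ"
    by (rule indep_var_restrict[OF X_indep]) auto
  have "prob ((\<lambda>\<omega>. (?XI \<omega>, ?XJ \<omega>)) -` (?A \<times> ?B) \<inter> space M)
      = prob (?XI -` ?A \<inter> space M) * prob (?XJ -` ?B \<inter> space M)"
    by (rule indep_varD[OF ind]) (auto intro!: sets_PiM_count_space)
  also have "(\<lambda>\<omega>. (?XI \<omega>, ?XJ \<omega>)) -` (?A \<times> ?B) \<inter> space M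
      = {\<omega> \<in> space M. Q (?XI \<omega>) \<and> R (\<Sum>j\<in>?J. X j \<omega>)}"
    by auto
  also have "?XI -` ?A \<inter> space M = {\<omega> \<in> space M. Q (?XI \<omega>)}" by auto
  also have "?XJ -` ?B \<inter> space M = {\<omega> \<in> space M. R (\<Sum>j\<in>?J. X j \<omega>)}" by auto
  also have "prob \<dots> = prob {\<omega> \<in> space M. R (walk X m \<omega>)}" by (rule prob_sum_X_shift)
  finally show ?thesis .
qed

end

section \<open>First-hit decomposition\<close>

context iid_int_walk begin

definition hit :: "nat \<Rightarrow> (nat \<Rightarrow> int) \<Rightarrow> int \<Rightarrow> nat \<Rightarrow> 'a \<Rightarrow> bool" where
  "hit N y x n \<omega> \<longleftrightarrow> (x + walk X n \<omega>) mod int N = y n mod int N"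

definition first_hit :: "nat \<Rightarrow> (nat \<Rightarrow> int) \<Rightarrow> int \<Rightarrow> nat \<Rightarrow> 'a \<Rightarrow> bool" where
  "first_hit N y x n \<omega> \<longleftrightarrow> hit N y x n \<omega> \<and> (\<forall>i\<in>{1..<n}. \<not> hit N y x i \<omega>)"

definition return_prob :: "nat \<Rightarrow> nat \<Rightarrow> int \<Rightarrow> real" where
  "return_prob N j d = prob {\<omega> \<in> space M. walk X j \<omega> mod int N = d mod int N}"

lemma hit_sets [measurable]: "Measurable.pred M (hit N y x n)"
  unfolding hit_def[abs_def] by measurable

lemma first_hit_sets [measurable]: "Measurable.pred M (first_hit N y x n)"
  unfolding first_hit_def[abs_def] by measurable

text \<open>The catching event splits into disjoint slices, one per starting point, and each slice
  has product form with a first factor of mass \<open>1 / N\<close>.\<close>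

lemma catch_prob_eq:
  assumes "1 \<le> N"
  shows "catch_prob M X N y
    = (\<Sum>x\<in>{0..<int N}. prob {\<omega> \<in> space M. \<exists>n\<in>{1..N}. hit N y x n \<omega>}) / real N"
proof -
  let ?U = "uniform_count_measure {0..<int N}"
  let ?B = "\<lambda>x. {\<omega> \<in> space M. \<exists>n\<in>{1..N}. hit N y x n \<omega>}"
  let ?E = "\<lambda>x. {x} \<times> ?B x"
  have B: "?B x \<in> sets M" for x by measurable
  have E: "emeasure (?U \<Otimes>\<^sub>M M) (?E x) = ennreal (prob (?B x) / real N)" if "x \<in> {0..<int N}" for x
  proof -
    have "emeasure (?U \<Otimes>\<^sub>M M) (?E x) = emeasure ?U {x} * emeasure M (?B x)"
      using that by (intro emeasure_pair_measure_Times B) (auto simp: sets_uniform_count_measure)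
    also have "emeasure ?U {x} = ennreal (1 / real N)"
      using that by (subst emeasure_uniform_count_measure) auto
    finally show ?thesis
      using assms by (simp add: emeasure_eq_measure ennreal_mult[symmetric] mult.commute)
  qed
  have "(\<Union>n\<in>{1..N}. {z \<in> space (rabbit_measure M N). rabbit X N n z = y n mod int N})
      = (\<Union>x\<in>{0..<int N}. ?E x)"
    by (auto simp: rabbit_measure_def space_pair_measure rabbit_def hit_def space_uniform_count_measure)
  then have "catch_prob M X N y = measure (?U \<Otimes>\<^sub>M M) (\<Union>x\<in>{0..<int N}. ?E x)"
    unfolding catch_prob_def rabbit_measure_def by simp
  also have "\<dots> = (\<Sum>x\<in>{0..<int N}. measure (?U \<Otimes>\<^sub>M M) (?E x))"
    by (rule measure_finite_Union)
       (use B E in \<open>auto simp: disjoint_family_on_def sets_uniform_count_measure\<close>)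
  also have "\<dots> = (\<Sum>x\<in>{0..<int N}. prob (?B x) / real N)"
    by (intro sum.cong refl measure_eq_emeasure_eq_ennreal E) auto
  finally show ?thesis by (simp add: sum_divide_distrib)
qed

text \<open>For every outcome exactly one starting point leads to a hit at time \<open>n\<close>,
  namely \<open>(y n - walk X n \<omega>) mod int N\<close>. The events thus partition the
  space.\<close>

lemma sum_prob_hit:
  assumes "1 \<le> N"
  shows "(\<Sum>x\<in>{0..<int N}. prob {\<omega> \<in> space M. hit N y x n \<omega>}) = 1"
proof -
  have "(\<Sum>x\<in>{0..<int N}. prob {\<omega> \<in> space M. hit N y x n \<omega>})
      = prob (\<Union>x\<in>{0..<int N}. {\<omega> \<in> space M. hit N y x n \<omega>})"
  proof (rule finite_measure_finite_Union[symmetric])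
    show "(\<lambda>x. {\<omega> \<in> space M. hit N y x n \<omega>}) ` {0..<int N} \<subseteq> events" by auto
    have "x = x'" if "x \<in> {0..<int N}" "x' \<in> {0..<int N}"
      "(x + w) mod int N = (x' + w) mod int N" for x x' w
    proof -
      have "(x + w - w) mod int N = (x' + w - w) mod int N"
        using that(3) by (metis mod_diff_left_eq)
      then show ?thesis using that by simp
    qed
    then have "x = x'" if "x \<in> {0..<int N}" "x' \<in> {0..<int N}" "hit N y x n \<omega>" "hit N y x' n \<omega>" for x x' \<omega>
      using that unfolding hit_def by metis
    then show "disjoint_family_on (\<lambda>x. {\<omega> \<in> space M. hit N y x n \<omega>}) {0..<int N}"
      unfolding disjoint_family_on_def by blast
  qed auto
  also have "(\<Union>x\<in>{0..<int N}. {\<omega> \<in> space M. hit N y x n \<omega>}) = space M"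
  proof -
    have "\<exists>x\<in>{0..<int N}. hit N y x n \<omega>" for \<omega>
    proof
      show "hit N y ((y n - walk X n \<omega>) mod int N) n \<omega>" by (simp add: hit_def mod_add_left_eq)
      show "(y n - walk X n \<omega>) mod int N \<in> {0..<int N}" using assms by simp
    qed
    then show ?thesis by auto
  qed
  finally show ?thesis by (simp add: prob_space)
qed

lemma first_hit_exists:
  assumes "n \<in> {1..m}" "hit N y x n \<omega>"
  shows "\<exists>i\<in>{1..m}. first_hit N y x i \<omega>"
proof -
  define k where "k = (LEAST i. 1 \<le> i \<and> hit N y x i \<omega>)"
  have k: "1 \<le> k \<and> hit N y x k \<omega>"
    unfolding k_def by (rule LeastI[of _ n]) (use assms in auto)
  have "k \<le> n" unfolding k_def by (rule Least_le) (use assms in auto)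
  moreover have "\<not> hit N y x i \<omega>" if "i \<in> {1..<k}" for i
    using not_less_Least[of i "\<lambda>i. 1 \<le> i \<and> hit N y x i \<omega>"] that unfolding k_def by auto
  ultimately have "first_hit N y x k \<omega>" "k \<in> {1..m}"
    using assms k by (auto simp: first_hit_def)
  then show ?thesis by blast
qed

lemma first_hit_unique: "first_hit N y x i \<omega> \<Longrightarrow> first_hit N y x j \<omega> \<Longrightarrow> 1 \<le> i \<Longrightarrow> 1 \<le> j \<Longrightarrow> i = j"
  unfolding first_hit_def by (cases i j rule: linorder_cases) auto

text \<open>First hits at different times are disjoint events. The predicate \<open>Q\<close> is a
  hit at time \<open>m\<close> in \<open>first_hit_identity\<close> and the sure event in
  \<open>catch_prob_eq_first_hit\<close>.\<close>

lemma sum_prob_first_hit: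
  assumes [measurable]: "Measurable.pred M Q"
  shows "(\<Sum>n=1..m. prob {\<omega> \<in> space M. first_hit N y x n \<omega> \<and> Q \<omega>})
    = prob {\<omega> \<in> space M. (\<exists>n\<in>{1..m}. hit N y x n \<omega>) \<and> Q \<omega>}"
proof -
  have "(\<Sum>n=1..m. prob {\<omega> \<in> space M. first_hit N y x n \<omega> \<and> Q \<omega>})
      = prob (\<Union>n\<in>{1..m}. {\<omega> \<in> space M. first_hit N y x n \<omega> \<and> Q \<omega>})"
    by (rule finite_measure_finite_Union[symmetric])
       (auto simp: disjoint_family_on_def dest: first_hit_unique)
  also have "(\<Union>n\<in>{1..m}. {\<omega> \<in> space M. first_hit N y x n \<omega> \<and> Q \<omega>})
      = {\<omega> \<in> space M. (\<exists>n\<in>{1..m}. hit N y x n \<omega>) \<and> Q \<omega>}"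
    using first_hit_exists[of _ m N y x] by (auto simp: first_hit_def)
  finally show ?thesis .
qed

lemma walk_add: "walk X (n + m) \<omega> = walk X n \<omega> + (\<Sum>j=n+1..n+m. X j \<omega>)"
  unfolding walk_def by (rule sum.ub_add_nat) simp

text \<open>On a hit at \<open>n\<close>, a hit at \<open>n + j\<close> is a condition on the steps
  after \<open>n\<close> alone, and these are independent of the first-hit event.\<close>

lemma prob_first_hit_and_hit:
  "prob {\<omega> \<in> space M. first_hit N y x n \<omega> \<and> hit N y x (n + j) \<omega>}
    = prob {\<omega> \<in> space M. first_hit N y x n \<omega>} * return_prob N j (y (n + j) - y n)"
proof -
  \<comment> \<open>\<open>h\<close> and \<open>Q\<close> restate hit and first hit as functionals
    of a sequence of steps, the form in which \<open>prob_prefix_and_increment\<close> takes the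
    past.\<close>
  define h where "h = (\<lambda>(f :: nat \<Rightarrow> int) i. (x + (\<Sum>k=1..i. f k)) mod int N = y i mod int N)"
  define Q where "Q = (\<lambda>f. h f n \<and> (\<forall>i\<in>{1..<n}. \<not> h f i))"
  have h: "h (\<lambda>i\<in>{1..n}. X i \<omega>) i = hit N y x i \<omega>" if "i \<le> n" for i \<omega>
    unfolding h_def hit_def walk_def using that by (intro arg_cong2[where f="(=)"] refl arg_cong2[where f="(mod)"] arg_cong2[where f="(+)"] sum.cong) auto
  have Q: "Q (\<lambda>i\<in>{1..n}. X i \<omega>) = first_hit N y x n \<omega>" for \<omega>
    unfolding Q_def first_hit_def using h by (metis atLeastLessThan_iff less_imp_le order_refl)
  have R: "hit N y x (n + j) \<omega> \<longleftrightarrow> (\<Sum>k=n+1..n+j. X k \<omega>) mod int N = (y (n + j) - y n) mod int N"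
    if "hit N y x n \<omega>" for \<omega>
  proof -
    let ?s = "\<Sum>k=n+1..n+j. X k \<omega>"
    have "hit N y x (n + j) \<omega> \<longleftrightarrow> int N dvd (x + walk X n \<omega> + ?s - y (n + j))"
      by (simp add: hit_def walk_add mod_eq_dvd_iff add.assoc)
    \<comment> \<open>The first bracket is a multiple of \<open>N\<close> by the hit at time
      \<open>n\<close>, which removes the starting point and the past.\<close>
    also have "x + walk X n \<omega> + ?s - y (n + j) = (x + walk X n \<omega> - y n) + (?s - (y (n + j) - y n))"
      by simp
    also have "int N dvd \<dots> \<longleftrightarrow> int N dvd (?s - (y (n + j) - y n))"
      using that by (intro dvd_add_right_iff) (simp add: hit_def mod_eq_dvd_iff)
    finally show ?thesis by (simp add: mod_eq_dvd_iff)
  qed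
  have "{\<omega> \<in> space M. first_hit N y x n \<omega> \<and> hit N y x (n + j) \<omega>}
      = {\<omega> \<in> space M. Q (\<lambda>i\<in>{1..n}. X i \<omega>) \<and>
          (\<Sum>k=n+1..n+j. X k \<omega>) mod int N = (y (n + j) - y n) mod int N}"
    unfolding Q using R by (auto simp: first_hit_def)
  then show ?thesis
    using prob_prefix_and_increment[of Q n "\<lambda>s. s mod int N = (y (n + j) - y n) mod int N" j]
    by (simp only: Q return_prob_def)
qed

text \<open>Both sides are the expected number of hits up to time \<open>L\<close>, summed over the
  starting points: the left by \<open>sum_prob_hit\<close>, the right by splitting at the first
  hit.\<close>

lemma first_hit_identity:
  assumes "1 \<le> N"
  shows "real L = (\<Sum>x\<in>{0..<int N}. \<Sum>n=1..L. prob {\<omega> \<in> space M. first_hit N y x n \<omega>}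
           * (\<Sum>j\<le>L - n. return_prob N j (y (n + j) - y n)))"
proof -
  have decomp: "prob {\<omega> \<in> space M. hit N y x m \<omega>}
      = (\<Sum>n=1..m. prob {\<omega> \<in> space M. first_hit N y x n \<omega>} * return_prob N (m - n) (y m - y n))"
    if "m \<in> {1..L}" for x m
  proof -
    have "{\<omega> \<in> space M. hit N y x m \<omega>}
        = {\<omega> \<in> space M. (\<exists>n\<in>{1..m}. hit N y x n \<omega>) \<and> hit N y x m \<omega>}"
      using that by auto
    then have "prob {\<omega> \<in> space M. hit N y x m \<omega>}
        = (\<Sum>n=1..m. prob {\<omega> \<in> space M. first_hit N y x n \<omega> \<and> hit N y x m \<omega>})"
      by (simp only: sum_prob_first_hit hit_sets)
    also have "\<dots> = (\<Sum>n=1..m. prob {\<omega> \<in> space M. first_hit N y x n \<omega>} * return_prob N (m - n) (y m - y n))"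
    proof (rule sum.cong)
      fix n assume "n \<in> {1..m}"
      then show "prob {\<omega> \<in> space M. first_hit N y x n \<omega> \<and> hit N y x m \<omega>}
         = prob {\<omega> \<in> space M. first_hit N y x n \<omega>} * return_prob N (m - n) (y m - y n)"
        using prob_first_hit_and_hit[of N y x n "m - n"] by simp
    qed simp
    finally show ?thesis .
  qed
  have inner: "(\<Sum>m=1..L. prob {\<omega> \<in> space M. hit N y x m \<omega>})
      = (\<Sum>n=1..L. prob {\<omega> \<in> space M. first_hit N y x n \<omega>}
           * (\<Sum>j\<le>L - n. return_prob N j (y (n + j) - y n)))" (is "?lhs x = ?rhs x") for x
  proof -
    let ?t = "\<lambda>n m. prob {\<omega> \<in> space M. first_hit N y x n \<omega>} * return_prob N (m - n) (y m - y n)"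
    have "?lhs x = (\<Sum>m=1..L. \<Sum>n=1..m. ?t n m)" by (intro sum.cong refl decomp)
    \<comment> \<open>The order of summation is exchanged over the triangle
      \<open>n \<le> m \<le> L\<close>; afterwards \<open>j = m - n\<close> is the time since the
      first hit.\<close>
    also have "\<dots> = (\<Sum>n=1..L. \<Sum>m=n..L. ?t n m)"
      by (subst (1 2) sum.Sigma) (auto intro!: sum.reindex_bij_witness[of _ "\<lambda>(n, m). (m, n)" "\<lambda>(m, n). (n, m)"])
    also have "\<dots> = ?rhs x"
    proof (rule sum.cong)
      fix n assume n: "n \<in> {1..L}"
      have "(\<Sum>m=n..L. ?t n m) = (\<Sum>j\<le>L - n. ?t n (n + j))"
        using n by (intro sum.reindex_bij_witness[of _ "\<lambda>j. n + j" "\<lambda>m. m - n"]) auto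
      then show "(\<Sum>m=n..L. ?t n m) = prob {\<omega> \<in> space M. first_hit N y x n \<omega>}
           * (\<Sum>j\<le>L - n. return_prob N j (y (n + j) - y n))"
        by (simp add: sum_distrib_left)
    qed simp
    finally show ?thesis .
  qed
  have "real L = (\<Sum>m=1..L. \<Sum>x\<in>{0..<int N}. prob {\<omega> \<in> space M. hit N y x m \<omega>})"
    by (simp add: sum_prob_hit[OF assms])
  also have "\<dots> = (\<Sum>x\<in>{0..<int N}. \<Sum>m=1..L. prob {\<omega> \<in> space M. hit N y x m \<omega>})" by (rule sum.swap)
  finally show ?thesis unfolding inner .
qed

lemma catch_prob_eq_first_hit:
  assumes "1 \<le> N"
  shows "(\<Sum>x\<in>{0..<int N}. \<Sum>n=1..N. prob {\<omega> \<in> space M. first_hit N y x n \<omega>}) = real N * catch_prob M X N y"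
  using assms sum_prob_first_hit[of "\<lambda>_. True" N y _ N] by (simp add: catch_prob_eq)

lemma catch_prob_lower:
  assumes "1 \<le> N"
    and G: "\<And>n. n \<in> {1..N} \<Longrightarrow> (\<Sum>j\<le>N - n. return_prob N j (y (n + j) - y n)) \<le> G"
  shows "1 \<le> G * catch_prob M X N y"
proof -
  have "real N \<le> (\<Sum>x\<in>{0..<int N}. \<Sum>n=1..N. prob {\<omega> \<in> space M. first_hit N y x n \<omega>} * G)"
    unfolding first_hit_identity[OF assms(1), of N y] by (intro sum_mono mult_left_mono G) auto
  also have "\<dots> = G * (real N * catch_prob M X N y)"
    unfolding catch_prob_eq_first_hit[OF assms(1), symmetric] by (simp add: sum_distrib_left mult.commute)
  finally have "real N * 1 \<le> real N * (G * catch_prob M X N y)" by (simp add: mult_ac)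
  then show ?thesis using assms(1) by (subst (asm) mult_le_cancel_left_pos) auto
qed

lemma catch_prob_upper:
  assumes "1 \<le> N"
    and g: "\<And>n. n \<in> {1..N} \<Longrightarrow> g \<le> (\<Sum>j\<le>2 * N - n. return_prob N j (y (n + j) - y n))"
  shows "g * catch_prob M X N y \<le> 2"
proof -
  have "g * (real N * catch_prob M X N y)
      = (\<Sum>x\<in>{0..<int N}. \<Sum>n=1..N. prob {\<omega> \<in> space M. first_hit N y x n \<omega>} * g)"
    unfolding catch_prob_eq_first_hit[OF assms(1), symmetric] by (simp add: sum_distrib_left mult.commute)
  also have "\<dots> \<le> (\<Sum>x\<in>{0..<int N}. \<Sum>n=1..N. prob {\<omega> \<in> space M. first_hit N y x n \<omega>}
           * (\<Sum>j\<le>2 * N - n. return_prob N j (y (n + j) - y n)))"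
    by (intro sum_mono mult_left_mono g) auto
  \<comment> \<open>First hits after time \<open>N\<close> add nonnegative terms, which completes
    the sum to the one in \<open>first_hit_identity\<close> with \<open>L = 2 * N\<close>.\<close>
  also have "\<dots> \<le> (\<Sum>x\<in>{0..<int N}. \<Sum>n=1..2 * N. prob {\<omega> \<in> space M. first_hit N y x n \<omega>}
           * (\<Sum>j\<le>2 * N - n. return_prob N j (y (n + j) - y n)))"
    by (intro sum_mono sum_mono2) (auto intro!: mult_nonneg_nonneg sum_nonneg simp: return_prob_def)
  also have "\<dots> = real (2 * N)"
    by (rule first_hit_identity[OF assms(1), symmetric])
  finally have "real N * (g * catch_prob M X N y) \<le> real N * 2" by (simp add: mult_ac)
  then show ?thesis using assms(1) by (subst (asm) mult_le_cancel_left_pos) auto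
qed

text \<open>Lets the path be altered beyond time \<open>N\<close>, where it does not enter the
  catching event.\<close>

lemma catch_prob_cong:
  "(\<And>n. n \<in> {1..N} \<Longrightarrow> y n = y' n) \<Longrightarrow> catch_prob M X N y = catch_prob M X N y'"
  unfolding catch_prob_def by (intro arg_cong2[where f=measure] refl SUP_cong) auto

end

section \<open>Fourier inversion and aperiodicity\<close>

lemma cis_eq_1_iff: "cis x = 1 \<longleftrightarrow> (\<exists>n::int. x = 2 * pi * of_int n)"
proof
  assume "cis x = 1"
  then have "cos x = 1" by (simp add: complex_eq_iff)
  then show "\<exists>n::int. x = 2 * pi * of_int n" by (auto simp: cos_one_2pi_int mult_ac)
qed auto

text \<open>Orthogonality of the characters of the cycle: a geometric sum with ratio
  \<open>z\<close> and \<open>z ^ N = 1\<close> vanishes unless \<open>z = 1\<close>.\<close>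

lemma sum_cis_roots_of_unity:
  fixes a :: int
  assumes "1 \<le> N"
  shows "(\<Sum>k<N. cis (2 * pi * real k / real N * of_int a)) = (if int N dvd a then of_nat N else 0)"
proof -
  define z where "z = cis (2 * pi * of_int a / real N)"
  have sum: "(\<Sum>k<N. cis (2 * pi * real k / real N * of_int a)) = (\<Sum>k<N. z ^ k)"
    by (intro sum.cong) (auto simp: z_def Complex.DeMoivre mult_ac)
  have "z ^ N = cis (2 * pi * of_int a)"
    using assms by (simp add: z_def Complex.DeMoivre)
  then have zN: "z ^ N = 1" by simp
  have "z = 1 \<longleftrightarrow> int N dvd a"
  proof
    assume "z = 1"
    then obtain n :: int where "2 * pi * of_int a / real N = 2 * pi * of_int n"
      unfolding z_def cis_eq_1_iff by auto
    then have "real_of_int a = real_of_int (int N * n)"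
      using assms by (simp add: field_simps)
    then show "int N dvd a" unfolding of_int_eq_iff by simp
  next
    assume "int N dvd a"
    then obtain n where "a = int N * n" by auto
    then have "2 * pi * of_int a / real N = 2 * pi * of_int n" using assms by simp
    then show "z = 1" unfolding z_def cis_eq_1_iff by blast
  qed
  then show ?thesis
    unfolding sum using assms zN by (cases "z = 1") (auto simp: sum_gp_strict)
qed

section \<open>Characteristic function of the step and inversion formulas\<close>

context iid_int_walk begin

lemma distr_X_density:
  "distr M (count_space UNIV) (X 1) = density (count_space UNIV) (\<lambda>k. ennreal (step_law M X k))"
proof (rule measure_eqI_countable[where A=UNIV])
  fix k :: int
  have "emeasure (distr M (count_space UNIV) (X 1)) {k} = emeasure M {\<omega> \<in> space M. X 1 \<omega> = k}"
    by (subst emeasure_distr) (auto intro!: X_measurable arg_cong[where f="emeasure M"])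
  then show "emeasure (distr M (count_space UNIV) (X 1)) {k}
      = emeasure (density (count_space UNIV) (\<lambda>k. ennreal (step_law M X k))) {k}"
    by (simp add: emeasure_density step_law_def emeasure_eq_measure nn_integral_count_space_indicator)
qed auto

lemma step_char_eq_expectation: "step_char \<theta> = expectation (\<lambda>\<omega>. cis (\<theta> * of_int (X 1 \<omega>)))"
  using expectation_cis_sum_X[of "{1}" \<theta>] by simp

text \<open>The expectation becomes a sum against the point masses; absolute summability, from
  boundedness of \<open>cis\<close>, then matches the two notions of infinite sum.\<close>

lemma step_char_eq_step_charfun: "step_char \<theta> = step_charfun M X \<theta>"
proof -
  let ?D = "distr M (count_space UNIV) (X 1)" and ?c = "\<lambda>k::int. cis (\<theta> * of_int k)"
  have [measurable]: "X 1 \<in> measurable M (count_space UNIV)" "X (Suc 0) \<in> measurable M (count_space UNIV)"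
    by (rule X_measurable; simp)+
  have "step_char \<theta> = integral\<^sup>L ?D ?c"
    unfolding step_char_eq_expectation by (subst integral_distr) auto
  also have "\<dots> = integral\<^sup>L (count_space UNIV) (\<lambda>k. step_law M X k *\<^sub>R ?c k)"
    unfolding distr_X_density by (subst integral_density) (auto simp: step_law_def)
  also have "\<dots> = infsetsum (\<lambda>k. step_law M X k *\<^sub>R ?c k) UNIV"
    by (simp add: infsetsum_def)
  also have "\<dots> = infsum (\<lambda>k. step_law M X k *\<^sub>R ?c k) UNIV"
  proof (rule infsetsum_infsum)
    have "prob_space ?D" by (rule prob_space_distr) simp
    then interpret D: prob_space ?D .
    have "integrable ?D ?c" by (rule D.integrable_const_bound[where B=1]) auto
    then have "integrable (count_space UNIV) (\<lambda>k. step_law M X k *\<^sub>R ?c k)"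
      unfolding distr_X_density by (subst (asm) integrable_density) (auto simp: step_law_def)
    then show "Infinite_Set_Sum.abs_summable_on (\<lambda>k. step_law M X k *\<^sub>R ?c k) UNIV"
      by (simp add: Infinite_Set_Sum.abs_summable_on_def)
  qed
  finally show ?thesis by (simp add: step_charfun_def scaleR_conv_of_real mult.commute)
qed

lemma real_distribution_step: "real_distribution (distr M borel (\<lambda>\<omega>. real_of_int (X 1 \<omega>)))"
  by (rule real_distribution_distr) (rule real_X_measurable, simp)

lemma step_char_periodic: "step_char (\<theta> + 2 * pi) = step_char \<theta>"
proof -
  have "cis ((\<theta> + 2 * pi) * of_int k) = cis (\<theta> * of_int k)" for k :: int
    by (simp add: cis_mult[symmetric] distrib_right)
  then show ?thesis by (simp add: step_char_eq_expectation)
qed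

lemma step_char_minus: "step_char (- \<theta>) = cnj (step_char \<theta>)"
  unfolding step_char_eq_expectation by (simp add: cis_cnj flip: Bochner_Integration.integral_cnj)

lemma integrable_cis_walk: "integrable M (\<lambda>\<omega>. cis (\<theta> * (of_int (walk X n \<omega>) - a)))"
  by (rule integrable_const_bound[where B=1]) auto

lemma expectation_cis_walk_minus:
  "expectation (\<lambda>\<omega>. cis (\<theta> * (of_int (walk X n \<omega>) - a))) = cis (- \<theta> * a) * step_char \<theta> ^ n"
proof -
  have "cis (\<theta> * (of_int (walk X n \<omega>) - a)) = cis (- \<theta> * a) * cis (\<theta> * of_int (walk X n \<omega>))" for \<omega>
    by (simp add: cis_mult algebra_simps)
  then show ?thesis by (simp add: expectation_cis_walk)
qed

lemma return_prob_ge: "prob {\<omega> \<in> space M. walk X j \<omega> = d} \<le> return_prob N j d"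
  unfolding return_prob_def by (intro finite_measure_mono) auto

text \<open>Orthogonality expands the event into frequencies; the triangle inequality then drops the
  phase, so the bound is uniform in \<open>d\<close>.\<close>

lemma return_prob_le:
  assumes "1 \<le> N"
  shows "return_prob N j d \<le> (\<Sum>k<N. cmod (step_char (2 * pi * real k / real N)) ^ j) / real N"
proof -
  let ?t = "\<lambda>k. 2 * pi * real k / real N"
  let ?A = "{\<omega> \<in> space M. walk X j \<omega> mod int N = d mod int N}"
  have "complex_of_real (return_prob N j d) = expectation (\<lambda>\<omega>. complex_of_real (indicator ?A \<omega>))"
    unfolding return_prob_def by (subst integral_complex_of_real) simp
  also have "\<dots> = expectation (\<lambda>\<omega>. (\<Sum>k<N. cis (?t k * (of_int (walk X j \<omega>) - of_int d))) / of_nat N)"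
  proof (rule Bochner_Integration.integral_cong)
    fix \<omega> assume "\<omega> \<in> space M"
    then show "complex_of_real (indicator ?A \<omega>) = (\<Sum>k<N. cis (?t k * (of_int (walk X j \<omega>) - of_int d))) / of_nat N"
      using assms sum_cis_roots_of_unity[OF assms, of "walk X j \<omega> - d"]
      by (auto simp: indicator_def mod_eq_dvd_iff)
  qed simp
  also have "\<dots> = (\<Sum>k<N. cis (- ?t k * of_int d) * step_char (?t k) ^ j) / of_nat N"
    by (simp only: integral_divide_zero Bochner_Integration.integral_sum integrable_cis_walk
        expectation_cis_walk_minus)
  finally have "return_prob N j d = cmod ((\<Sum>k<N. cis (- ?t k * of_int d) * step_char (?t k) ^ j) / of_nat N)"
    by (metis norm_of_real abs_of_nonneg return_prob_def measure_nonneg)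
  also have "\<dots> = cmod (\<Sum>k<N. cis (- ?t k * of_int d) * step_char (?t k) ^ j) / real N"
    by (simp add: norm_divide)
  also have "\<dots> \<le> (\<Sum>k<N. cmod (step_char (?t k)) ^ j) / real N"
    by (intro divide_right_mono sum_norm_le) (auto simp: norm_mult norm_power)
  finally show ?thesis .
qed

text \<open>Fourier inversion on the integers, carried out with cosines: over a full period the
  integral of \<open>cos (\<theta> * a)\<close> with integer \<open>a\<close> vanishes unless
  \<open>a = 0\<close>.\<close>

lemma prob_walk_eq_integral:
  "2 * pi * prob {\<omega> \<in> space M. walk X n \<omega> = z}
    = (\<integral>\<theta>. indicator {-pi..pi} \<theta> *\<^sub>R Re (cis (- \<theta> * of_int z) * step_char \<theta> ^ n) \<partial>lborel)"
proof -
  let ?g = "\<lambda>\<theta> \<omega>. indicator {-pi..pi} \<theta> *\<^sub>R cos (\<theta> * (of_int (walk X n \<omega>) - of_int z))"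
  interpret P: pair_sigma_finite lborel M ..
  have inner: "(\<integral>\<theta>. ?g \<theta> \<omega> \<partial>lborel) = 2 * pi * indicator {\<omega>. walk X n \<omega> = z} \<omega>" for \<omega>
  proof (cases "walk X n \<omega> = z")
    case True
    then show ?thesis by simp
  next
    case False
    define a :: real where "a = of_int (walk X n \<omega>) - of_int z"
    have a: "a \<noteq> 0" using False by (simp add: a_def)
    have "(\<integral>\<theta>. indicator {-pi..pi} \<theta> *\<^sub>R cos (\<theta> * a) \<partial>lborel) = sin (pi * a) / a - sin (- pi * a) / a"
      by (rule integral_FTC_atLeastAtMost)
         (use a in \<open>auto intro!: derivative_eq_intros continuous_intros
            simp: has_real_derivative_iff_has_vector_derivative[symmetric]\<close>)
    moreover have "sin (pi * a) = 0"
      unfolding a_def by (subst sin_zero_iff_int2) (auto intro!: exI[of _ "walk X n \<omega> - z"])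
    ultimately show ?thesis using False by (simp add: a_def)
  qed
  \<comment> \<open>Fubini applies because the integrand is bounded by the indicator of an interval
    of finite length and \<open>M\<close> is a probability measure.\<close>
  have int: "integrable (lborel \<Otimes>\<^sub>M M) (case_prod ?g)"
  proof (rule P.Fubini_integrable)
    have "(\<lambda>\<omega>. real_of_int (walk X n \<omega>)) \<in> borel_measurable M"
      by (rule measurable_compose[OF walk_measurable]) auto
    then show "case_prod ?g \<in> borel_measurable (lborel \<Otimes>\<^sub>M M)" by measurable
    show "AE \<theta> in lborel. integrable M (\<lambda>\<omega>. case_prod ?g (\<theta>, \<omega>))"
      by (intro always_eventually allI integrable_const_bound[where B=1]) (auto simp: indicator_def)
    show "integrable lborel (\<lambda>\<theta>. \<integral>\<omega>. norm (case_prod ?g (\<theta>, \<omega>)) \<partial>M)"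
    proof (rule Bochner_Integration.integrable_bound[where f="indicator {-pi..pi} :: real \<Rightarrow> real"])
      show "(\<lambda>\<theta>. \<integral>\<omega>. norm (case_prod ?g (\<theta>, \<omega>)) \<partial>M) \<in> borel_measurable lborel"
        using \<open>(\<lambda>\<omega>. real_of_int (walk X n \<omega>)) \<in> borel_measurable M\<close> by measurable
      show "AE \<theta> in lborel. norm (\<integral>\<omega>. norm (case_prod ?g (\<theta>, \<omega>)) \<partial>M) \<le> norm (indicator {-pi..pi} \<theta> :: real)"
      proof (intro always_eventually allI)
        fix \<theta> :: real
        have "(\<integral>\<omega>. norm (case_prod ?g (\<theta>, \<omega>)) \<partial>M) \<le> (\<integral>\<omega>. indicator {-pi..pi} \<theta> \<partial>M)"
          by (intro integral_mono integrable_const_bound[where B=1]) (auto simp: indicator_def)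
        then show "norm (\<integral>\<omega>. norm (case_prod ?g (\<theta>, \<omega>)) \<partial>M) \<le> norm (indicator {-pi..pi} \<theta> :: real)"
          by (simp add: prob_space)
      qed
    qed simp
  qed
  have "2 * pi * prob {\<omega> \<in> space M. walk X n \<omega> = z} = (\<integral>\<omega>. 2 * pi * indicator {\<omega>. walk X n \<omega> = z} \<omega> \<partial>M)"
    by (simp add: Int_def conj_commute)
  also have "\<dots> = (\<integral>\<omega>. (\<integral>\<theta>. ?g \<theta> \<omega> \<partial>lborel) \<partial>M)" by (simp only: inner)
  also have "\<dots> = (\<integral>\<theta>. (\<integral>\<omega>. ?g \<theta> \<omega> \<partial>M) \<partial>lborel)" by (rule P.Fubini_integral[OF int])
  also have "\<dots> = (\<integral>\<theta>. indicator {-pi..pi} \<theta> *\<^sub>R Re (cis (- \<theta> * of_int z) * step_char \<theta> ^ n) \<partial>lborel)"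
  proof (intro Bochner_Integration.integral_cong refl)
    fix \<theta> :: real
    have "(\<integral>\<omega>. ?g \<theta> \<omega> \<partial>M) = indicator {-pi..pi} \<theta> *\<^sub>R (\<integral>\<omega>. Re (cis (\<theta> * (of_int (walk X n \<omega>) - of_int z))) \<partial>M)"
      by simp
    also have "(\<integral>\<omega>. Re (cis (\<theta> * (of_int (walk X n \<omega>) - of_int z))) \<partial>M)
        = Re (cis (- \<theta> * of_int z) * step_char \<theta> ^ n)"
      unfolding expectation_cis_walk_minus[symmetric] by (rule integral_Re[OF integrable_cis_walk])
    finally show "(\<integral>\<omega>. ?g \<theta> \<omega> \<partial>M) = indicator {-pi..pi} \<theta> *\<^sub>R Re (cis (- \<theta> * of_int z) * step_char \<theta> ^ n)" .
  qed
  finally show ?thesis .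
qed

text \<open>If the modulus were \<open>1\<close>, the real value would be \<open>s = 1\<close> or
  \<open>s = - 1\<close>, and \<open>s * cos (\<theta> * X 1)\<close> would be almost surely
  \<open>1\<close>. Then \<open>cis (\<theta> * k) = s\<close> on the whole support, so its
  differences lie in the subgroup \<open>G\<close> of all \<open>a\<close> with
  \<open>cis (\<theta> * a) = 1\<close>. Aperiodicity puts \<open>1\<close> into \<open>G\<close>,
  against \<open>0 < \<theta> < 2 * pi\<close>.\<close>

lemma cmod_step_char_less_1:
  assumes aper: "strongly_aperiodic M X" and \<theta>: "0 < \<theta>" "\<theta> < 2 * pi"
    and real: "Im (step_char \<theta>) = 0"
  shows "cmod (step_char \<theta>) < 1"
proof (rule ccontr)
  assume "\<not> ?thesis"
  moreover have "cmod (step_char \<theta>) \<le> 1"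
    unfolding step_char_def by (rule real_distribution.cmod_char_le_1[OF real_distribution_step])
  ultimately have abs: "\<bar>Re (step_char \<theta>)\<bar> = 1"
    using real by (simp add: cmod_eq_Re)
  define s where "s = Re (step_char \<theta>)"
  have s: "s = 1 \<or> s = - 1" using abs unfolding s_def by linarith
  have [measurable]: "X 1 \<in> measurable M (count_space UNIV)" "X (Suc 0) \<in> measurable M (count_space UNIV)"
    by (rule X_measurable; simp)+
  have intc: "integrable M (\<lambda>\<omega>. cis (\<theta> * of_int (X 1 \<omega>)))"
    by (rule integrable_const_bound[where B=1]) auto
  have cos_int: "integrable M (\<lambda>\<omega>. cos (\<theta> * of_int (X 1 \<omega>)))"
    by (rule integrable_const_bound[where B=1]) auto
  have "expectation (\<lambda>\<omega>. cos (\<theta> * of_int (X 1 \<omega>))) = s"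
    using integral_Re[OF intc] by (simp add: s_def step_char_eq_expectation)
  then have "expectation (\<lambda>\<omega>. 1 - s * cos (\<theta> * of_int (X 1 \<omega>))) = 0"
    using cos_int s by (auto simp: prob_space)
  moreover have le: "s * cos t \<le> 1" for t
    using s cos_le_one[of t] cos_ge_minus_one[of t] by auto
  ultimately have AE: "AE \<omega> in M. 1 - s * cos (\<theta> * of_int (X 1 \<omega>)) = 0"
    using cos_int by (subst (asm) integral_nonneg_eq_0_iff_AE) auto
  have support: "cis (\<theta> * of_int k) = of_real s" if "step_law M X k > 0" for k
  proof -
    have "1 - s * cos (\<theta> * of_int k) = 0"
    proof (rule ccontr)
      assume neq: "1 - s * cos (\<theta> * of_int k) \<noteq> 0"
      have "AE \<omega> in M. \<not> X 1 \<omega> = k" using AE by eventually_elim (use neq in auto)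
      then have "prob {\<omega> \<in> space M. X 1 \<omega> = k} = 0"
        by (subst (asm) AE_iff_measurable[where N="{\<omega> \<in> space M. X 1 \<omega> = k}"])
           (auto simp: emeasure_eq_measure)
      then show False using that by (simp add: step_law_def)
    qed
    then have c: "cos (\<theta> * of_int k) = s"
      using s by auto
    have "(sin (\<theta> * of_int k))\<^sup>2 = 0"
      using sin_cos_squared_add[of "\<theta> * of_int k"] c s by (auto simp add: power2_eq_square)
    then show ?thesis using c by (simp add: complex_eq_iff)
  qed
  obtain k0 where k0: "step_law M X k0 > 0"
  proof -
    have "\<exists>k. step_law M X k > 0"
    proof (rule ccontr)
      assume "\<not> ?thesis"
      then have "step_law M X k = 0" for k
        by (metis step_law_def measure_nonneg less_eq_real_def)
      then have "step_charfun M X \<theta> = 0" by (simp add: step_charfun_def)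
      then show False using abs by (simp add: step_char_eq_step_charfun)
    qed
    then show ?thesis using that by blast
  qed
  define G where "G = {a::int. cis (\<theta> * of_int a) = 1}"
  have "int_subgroup G"
    unfolding int_subgroup_def G_def by (auto simp: right_diff_distrib cis_divide[symmetric])
  \<comment> \<open>Shifting by \<open>- k0\<close> cancels the common value \<open>s\<close>, so
    the parity case \<open>s = - 1\<close> is excluded as well.\<close>
  moreover have "{- k0 + k | k. step_law M X k > 0} \<subseteq> G"
  proof clarify
    fix k assume "step_law M X k > 0"
    then have "cis (\<theta> * of_int k) / cis (\<theta> * of_int k0) = 1"
      using support k0 s by auto
    then show "- k0 + k \<in> G" by (simp add: G_def cis_divide algebra_simps)
  qed
  ultimately have "int_subgroup hull {- k0 + k | k. step_law M X k > 0} \<subseteq> G"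
    by (intro hull_minimal)
  then have "1 \<in> G" using aper unfolding strongly_aperiodic_def by (metis UNIV_I subsetD)
  then obtain n :: int where "\<theta> = 2 * pi * of_int n" by (auto simp: G_def cis_eq_1_iff)
  with \<theta> have "0 < real_of_int n" "real_of_int n < 1"
    by (auto simp: zero_less_mult_iff)
  then show False by simp
qed

end

section \<open>Spectral gap\<close>

text \<open>A real-variable model of the characteristic function of a symmetric law;
  \<open>s\<close> will be the smaller of \<open>\<epsilon>\<close> and \<open>1\<close>, as the
  power sums require \<open>s \<le> 1\<close>.\<close>

locale stable_multiplier =
  fixes \<phi> :: "real \<Rightarrow> real" and \<beta> c s :: real
  assumes cont: "isCont \<phi> \<theta>" and at_0: "\<phi> 0 = 1"
    and even: "\<phi> (- \<theta>) = \<phi> \<theta>" and periodic: "\<phi> (\<theta> + 2 * pi) = \<phi> \<theta>"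
    and abs_le_1: "\<bar>\<phi> \<theta>\<bar> \<le> 1" and abs_less_1: "0 < \<theta> \<Longrightarrow> \<theta> \<le> pi \<Longrightarrow> \<bar>\<phi> \<theta>\<bar> < 1"
    and \<beta>_pos: "0 < \<beta>" and c_pos: "0 < c" and s_pos: "0 < s" and s_le_1: "s \<le> 1"
    and expansion: "\<exists>K. eventually (\<lambda>\<theta>. \<bar>\<phi> \<theta> - (1 - c * \<bar>\<theta>\<bar> powr \<beta>)\<bar> \<le> K * \<bar>\<theta>\<bar> powr (\<beta> + s)) (at 0)"
begin

sublocale circle_multiplier "\<lambda>\<theta>. \<bar>\<phi> \<theta>\<bar>"
proof
  show "\<bar>\<phi> (2 * pi - \<theta>)\<bar> = \<bar>\<phi> \<theta>\<bar>" for \<theta>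
    using periodic[of "- \<theta>"] even[of \<theta>] by simp
qed (auto intro: abs_le_1 abs_less_1)

text \<open>Fixes one right neighbourhood of \<open>0\<close> where the absolute value of
  \<open>\<phi>\<close> is \<open>\<phi>\<close> itself and the error is at most half of the main
  term \<open>c * \<theta> powr \<beta>\<close>.\<close>

lemma near_0:
  obtains K \<delta> where "0 < K" "0 < \<delta>"
    "\<And>\<theta>. 0 < \<theta> \<Longrightarrow> \<theta> < \<delta> \<Longrightarrow> \<bar>\<phi> \<theta> - (1 - c * \<theta> powr \<beta>)\<bar> \<le> K * \<theta> powr (\<beta> + s)"
    "\<And>\<theta>. 0 < \<theta> \<Longrightarrow> \<theta> < \<delta> \<Longrightarrow> 0 < \<phi> \<theta>"
    "\<And>\<theta>. 0 < \<theta> \<Longrightarrow> \<theta> < \<delta> \<Longrightarrow> K * \<theta> powr s \<le> c / 2"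
proof -
  obtain K where K: "eventually (\<lambda>\<theta>. \<bar>\<phi> \<theta> - (1 - c * \<bar>\<theta>\<bar> powr \<beta>)\<bar> \<le> K * \<bar>\<theta>\<bar> powr (\<beta> + s)) (at 0)"
    using expansion by blast
  define K' where "K' = max K 1"
  have "((\<lambda>\<theta>. K' * \<theta> powr s) \<longlongrightarrow> K' * 0 powr s) (at_right 0)"
    using s_pos by (intro tendsto_intros) (auto simp: eventually_at_filter)
  then have "((\<lambda>\<theta>. K' * \<theta> powr s) \<longlongrightarrow> 0) (at_right 0)" by simp
  then have "eventually (\<lambda>\<theta>. K' * \<theta> powr s < c / 2) (at_right 0)"
    using c_pos by (intro order_tendstoD) auto
  moreover have "eventually (\<lambda>\<theta>. 0 < \<phi> \<theta>) (at_right 0)"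
  proof (rule order_tendstoD)
    show "(\<phi> \<longlongrightarrow> 1) (at_right 0)"
      using cont[of 0] at_0 by (metis continuous_within filterlim_at_split)
  qed simp
  moreover have "eventually (\<lambda>\<theta>. \<bar>\<phi> \<theta> - (1 - c * \<bar>\<theta>\<bar> powr \<beta>)\<bar> \<le> K * \<bar>\<theta>\<bar> powr (\<beta> + s)) (at_right 0)"
    using K by (simp add: eventually_at_split)
  ultimately have "eventually (\<lambda>\<theta>. K' * \<theta> powr s < c / 2 \<and> 0 < \<phi> \<theta> \<and>
      \<bar>\<phi> \<theta> - (1 - c * \<bar>\<theta>\<bar> powr \<beta>)\<bar> \<le> K * \<bar>\<theta>\<bar> powr (\<beta> + s)) (at_right 0)"
    by eventually_elim auto
  then obtain \<delta> where \<delta>: "0 < \<delta>" "\<And>\<theta>. 0 < \<theta> \<Longrightarrow> \<theta> < \<delta> \<Longrightarrow> K' * \<theta> powr s < c / 2 \<and> 0 < \<phi> \<theta> \<and>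
      \<bar>\<phi> \<theta> - (1 - c * \<bar>\<theta>\<bar> powr \<beta>)\<bar> \<le> K * \<bar>\<theta>\<bar> powr (\<beta> + s)"
    unfolding eventually_at_right_field by auto
  show ?thesis
  proof (rule that[of K' \<delta>])
    fix \<theta> :: real assume \<theta>: "0 < \<theta>" "\<theta> < \<delta>"
    have "\<bar>\<phi> \<theta> - (1 - c * \<theta> powr \<beta>)\<bar> \<le> K * \<theta> powr (\<beta> + s)" using \<delta>(2)[OF \<theta>] \<theta> by simp
    also have "\<dots> \<le> K' * \<theta> powr (\<beta> + s)" by (intro mult_right_mono) (auto simp: K'_def)
    finally show "\<bar>\<phi> \<theta> - (1 - c * \<theta> powr \<beta>)\<bar> \<le> K' * \<theta> powr (\<beta> + s)" .
    show "0 < \<phi> \<theta>" "K' * \<theta> powr s \<le> c / 2" using \<delta>(2)[OF \<theta>] by auto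
  qed (use \<delta> in \<open>auto simp: K'_def\<close>)
qed

text \<open>Continuity and compactness of the interval from \<open>\<delta>\<close> to
  \<open>pi\<close>; if \<open>\<delta> > pi\<close> the range is empty and any positive constant
  serves.\<close>

lemma away_from_0:
  assumes "0 < \<delta>"
  obtains b where "0 < b" "\<And>\<theta>. \<delta> \<le> \<theta> \<Longrightarrow> \<theta> \<le> pi \<Longrightarrow> b \<le> 1 - \<bar>\<phi> \<theta>\<bar>"
proof (cases "\<delta> \<le> pi")
  case True
  have "continuous_on {\<delta>..pi} (\<lambda>\<theta>. \<bar>\<phi> \<theta>\<bar>)"
    by (intro continuous_on_rabs continuous_at_imp_continuous_on ballI cont)
  then obtain \<theta>0 where "\<theta>0 \<in> {\<delta>..pi}" "\<And>\<theta>. \<theta> \<in> {\<delta>..pi} \<Longrightarrow> \<bar>\<phi> \<theta>\<bar> \<le> \<bar>\<phi> \<theta>0\<bar>"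
    using continuous_attains_sup[of "{\<delta>..pi}" "\<lambda>\<theta>. \<bar>\<phi> \<theta>\<bar>"] True by auto
  then show ?thesis
    using abs_less_1[of \<theta>0] assms by (intro that[of "1 - \<bar>\<phi> \<theta>0\<bar>"]) auto
next
  case False
  then show ?thesis by (intro that[of 1]) auto
qed

lemma gap:
  obtains a where "0 < a" "\<And>\<theta>. 0 < \<theta> \<Longrightarrow> \<theta> \<le> pi \<Longrightarrow> a * \<theta> powr \<beta> \<le> 1 - \<bar>\<phi> \<theta>\<bar>"
proof -
  obtain K \<delta> where K: "0 < K" "0 < \<delta>"
    and expn: "\<And>\<theta>. 0 < \<theta> \<Longrightarrow> \<theta> < \<delta> \<Longrightarrow> \<bar>\<phi> \<theta> - (1 - c * \<theta> powr \<beta>)\<bar> \<le> K * \<theta> powr (\<beta> + s)"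
    and pos: "\<And>\<theta>. 0 < \<theta> \<Longrightarrow> \<theta> < \<delta> \<Longrightarrow> 0 < \<phi> \<theta>"
    and small: "\<And>\<theta>. 0 < \<theta> \<Longrightarrow> \<theta> < \<delta> \<Longrightarrow> K * \<theta> powr s \<le> c / 2"
    using near_0 by blast
  obtain b where b: "0 < b" "\<And>\<theta>. \<delta> \<le> \<theta> \<Longrightarrow> \<theta> \<le> pi \<Longrightarrow> b \<le> 1 - \<bar>\<phi> \<theta>\<bar>"
    using away_from_0[OF \<open>0 < \<delta>\<close>] by blast
  \<comment> \<open>Near \<open>0\<close> half of the main term survives; elsewhere the constant gap
    \<open>b\<close> is compared with \<open>\<theta> powr \<beta>\<close> through its maximum
    \<open>pi powr \<beta>\<close>.\<close>
  show ?thesis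
  proof (rule that[of "min (c / 2) (b / pi powr \<beta>)"])
    fix \<theta> :: real assume \<theta>: "0 < \<theta>" "\<theta> \<le> pi"
    show "min (c / 2) (b / pi powr \<beta>) * \<theta> powr \<beta> \<le> 1 - \<bar>\<phi> \<theta>\<bar>"
    proof (cases "\<theta> < \<delta>")
      case True
      have "K * \<theta> powr (\<beta> + s) = K * \<theta> powr s * \<theta> powr \<beta>" by (simp add: powr_add)
      also have "\<dots> \<le> c / 2 * \<theta> powr \<beta>"
        using small[of \<theta>] \<theta> True by (intro mult_right_mono) auto
      finally have "c / 2 * \<theta> powr \<beta> \<le> 1 - \<bar>\<phi> \<theta>\<bar>"
        using expn[of \<theta>] pos[of \<theta>] \<theta> True by (simp add: abs_le_iff)
      moreover have "min (c / 2) (b / pi powr \<beta>) * \<theta> powr \<beta> \<le> c / 2 * \<theta> powr \<beta>"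
        by (intro mult_right_mono min.cobounded1) auto
      ultimately show ?thesis by simp
    next
      case False
      have "min (c / 2) (b / pi powr \<beta>) * \<theta> powr \<beta> \<le> b / pi powr \<beta> * pi powr \<beta>"
        using \<theta> b \<beta>_pos by (intro mult_mono powr_mono2) auto
      also have "\<dots> = b" by simp
      finally show ?thesis using b(2)[of \<theta>] False \<theta> by simp
    qed
  qed (use b c_pos in auto)
qed

lemma inverse_gap:
  obtains C where "0 < C" "\<And>\<theta>. 0 < \<theta> \<Longrightarrow> \<theta> \<le> pi \<Longrightarrow> 1 / (1 - \<bar>\<phi> \<theta>\<bar>) \<le> C * \<theta> powr (- \<beta>)"
proof -
  obtain a where a: "0 < a" "\<And>\<theta>. 0 < \<theta> \<Longrightarrow> \<theta> \<le> pi \<Longrightarrow> a * \<theta> powr \<beta> \<le> 1 - \<bar>\<phi> \<theta>\<bar>"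
    using gap by blast
  show ?thesis
  proof (rule that[of "1 / a"])
    fix \<theta> :: real assume \<theta>: "0 < \<theta>" "\<theta> \<le> pi"
    have "1 / (1 - \<bar>\<phi> \<theta>\<bar>) \<le> 1 / (a * \<theta> powr \<beta>)"
      using a \<theta> by (intro divide_left_mono) (auto intro!: mult_pos_pos abs_less_1)
    then show "1 / (1 - \<bar>\<phi> \<theta>\<bar>) \<le> 1 / a * \<theta> powr (- \<beta>)" by (simp add: powr_minus_divide)
  qed (use a in auto)
qed

text \<open>With main term \<open>u\<close> and error \<open>v\<close>,
  \<open>1 / (u - v) = 1 / u + v / (u * (u - v))\<close>. As \<open>v \<le> u / 2\<close>, the last
  term is of order \<open>v / u^2\<close>, that is \<open>\<theta> powr (s - 1)\<close>. Keeping
  \<open>1 / c\<close> exact fixes the coefficient of the logarithm.\<close>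

lemma inverse_gap_sharp:
  assumes "\<beta> = 1"
  obtains C where "0 < C"
    "\<And>\<theta>. 0 < \<theta> \<Longrightarrow> \<theta> \<le> pi \<Longrightarrow> 1 / (1 - \<bar>\<phi> \<theta>\<bar>) \<le> 1 / c / \<theta> + C * \<theta> powr (s - 1)"
proof -
  obtain K \<delta> where K: "0 < K" "0 < \<delta>"
    and expn: "\<And>\<theta>. 0 < \<theta> \<Longrightarrow> \<theta> < \<delta> \<Longrightarrow> \<bar>\<phi> \<theta> - (1 - c * \<theta> powr \<beta>)\<bar> \<le> K * \<theta> powr (\<beta> + s)"
    and pos: "\<And>\<theta>. 0 < \<theta> \<Longrightarrow> \<theta> < \<delta> \<Longrightarrow> 0 < \<phi> \<theta>"
    and small: "\<And>\<theta>. 0 < \<theta> \<Longrightarrow> \<theta> < \<delta> \<Longrightarrow> K * \<theta> powr s \<le> c / 2"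
    using near_0 by blast
  obtain b where b: "0 < b" "\<And>\<theta>. \<delta> \<le> \<theta> \<Longrightarrow> \<theta> \<le> pi \<Longrightarrow> b \<le> 1 - \<bar>\<phi> \<theta>\<bar>"
    using away_from_0[OF \<open>0 < \<delta>\<close>] by blast
  \<comment> \<open>The first entry serves near \<open>0\<close>; the second turns the constant
    \<open>1 / b\<close> away from \<open>0\<close> into a multiple of
    \<open>\<theta> powr (s - 1)\<close>.\<close>
  define C where "C = max (2 * K / c\<^sup>2) (pi powr (1 - s) / b)"
  show ?thesis
  proof (rule that[of C])
    show "0 < C" using K c_pos by (auto simp: C_def less_max_iff_disj)
    fix \<theta> :: real assume \<theta>: "0 < \<theta>" "\<theta> \<le> pi"
    show "1 / (1 - \<bar>\<phi> \<theta>\<bar>) \<le> 1 / c / \<theta> + C * \<theta> powr (s - 1)"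
    proof (cases "\<theta> < \<delta>")
      case True
      define u where "u = c * \<theta>"
      define v where "v = K * \<theta> powr s * \<theta>"
      have u: "0 < u" using \<theta> c_pos by (simp add: u_def)
      have v0: "0 \<le> v" using K \<theta> by (simp add: v_def)
      have "v \<le> c / 2 * \<theta>"
        unfolding v_def using small[of \<theta>] \<theta> True by (intro mult_right_mono) auto
      then have v: "v \<le> u / 2" by (simp add: u_def)
      have "u - v \<le> 1 - \<bar>\<phi> \<theta>\<bar>"
        using expn[of \<theta>] pos[of \<theta>] \<theta> True assms by (simp add: abs_le_iff u_def v_def powr_add mult_ac)
      then have "1 / (1 - \<bar>\<phi> \<theta>\<bar>) \<le> 1 / (u - v)"
        using u v by (intro divide_left_mono) (auto intro!: mult_pos_pos)
      also have "\<dots> = 1 / u + v / (u * (u - v))"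
        using u v by (simp add: field_simps)
      also have "v / (u * (u - v)) \<le> v / (u * (u / 2))"
        using u v v0 by (intro divide_left_mono mult_left_mono) (auto intro!: mult_pos_pos)
      also have "v / (u * (u / 2)) = 2 * K / c\<^sup>2 * \<theta> powr (s - 1)"
        using \<theta> c_pos by (simp add: u_def v_def powr_diff power2_eq_square field_simps)
      also have "\<dots> \<le> C * \<theta> powr (s - 1)"
        by (intro mult_right_mono) (auto simp: C_def)
      finally show ?thesis by (simp add: u_def)
    next
      case False
      have "1 / (1 - \<bar>\<phi> \<theta>\<bar>) \<le> 1 / b"
        using b \<theta> False by (intro divide_left_mono) (auto intro!: mult_pos_pos abs_less_1)
      also have "1 / b = \<theta> powr (1 - s) / b * \<theta> powr (s - 1)"
        using \<theta> by (simp add: powr_add[symmetric])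
      also have "\<dots> \<le> pi powr (1 - s) / b * \<theta> powr (s - 1)"
        using \<theta> b s_le_1 by (intro mult_right_mono divide_right_mono powr_mono2) auto
      also have "\<dots> \<le> C * \<theta> powr (s - 1)"
        by (intro mult_right_mono) (auto simp: C_def)
      also have "\<dots> \<le> 1 / c / \<theta> + C * \<theta> powr (s - 1)"
        using \<theta> c_pos by simp
      finally show ?thesis .
    qed
  qed
qed

end

section \<open>Local limit theorem for the Cauchy case\<close>

lemma integrable_exp_abs:
  assumes "0 < (c::real)"
  shows "integrable lborel (\<lambda>t. exp (- c * \<bar>t\<bar>))"
proof -
  have "set_integrable lborel {0..} (\<lambda>t. exp (- (t * c)))"
    using set_integrable_discrete_difference[of "{0}" "{0<..}" "{0..}" lborel "\<lambda>t. exp (- (t * c))"]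
      integrable_I0i_exp_mscale[OF assms] by force
  then have "integrable lborel (\<lambda>t. indicator {0..} t *\<^sub>R exp (- c * \<bar>t\<bar>))"
    unfolding set_integrable_def
    by (rule Bochner_Integration.integrable_cong[THEN iffD1, rotated -1]) (auto simp: indicator_def mult.commute)
  then have "has_bochner_integral lborel (\<lambda>t. indicator {0..} t *\<^sub>R exp (- c * \<bar>t\<bar>))
      (\<integral>t. indicator {0..} t *\<^sub>R exp (- c * \<bar>t\<bar>) \<partial>lborel)"
    by (rule has_bochner_integral_integrable)
  from has_bochner_integral_even_function[OF this] show ?thesis
    by (auto intro: integrable.intros)
qed

text \<open>The Fourier transform of the two-sided exponential is a multiple of the Cauchy density.
  The half-line integral comes from the antiderivative \<open>F\<close> and a limit; evenness
  doubles it.\<close>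

lemma integral_exp_abs_cos:
  assumes "0 < (c::real)"
  shows "(\<integral>t. exp (- c * \<bar>t\<bar>) * cos (t * x) \<partial>lborel) = 2 * c / (c\<^sup>2 + x\<^sup>2)"
proof -
  let ?f = "\<lambda>t. exp (- c * \<bar>t\<bar>) * cos (t * x)"
  define F where "F = (\<lambda>t. exp (- c * t) * (x * sin (t * x) - c * cos (t * x)) / (c\<^sup>2 + x\<^sup>2))"
  have pos: "0 < c\<^sup>2 + x\<^sup>2" using assms by (simp add: add_pos_nonneg)
  have F': "(F has_real_derivative exp (- c * t) * cos (t * x)) (at t within A)" for t A
  proof -
    have "(F has_real_derivative
        (exp (- c * t) * (- c) * (x * sin (t * x) - c * cos (t * x))
          + exp (- c * t) * (x * (cos (t * x) * x) + c * (sin (t * x) * x))) / (c\<^sup>2 + x\<^sup>2)) (at t within A)"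
      unfolding F_def by (auto intro!: derivative_eq_intros) (use pos in \<open>simp add: algebra_simps\<close>)
    also have "(exp (- c * t) * (- c) * (x * sin (t * x) - c * cos (t * x))
          + exp (- c * t) * (x * (cos (t * x) * x) + c * (sin (t * x) * x)))
        = exp (- c * t) * cos (t * x) * (c\<^sup>2 + x\<^sup>2)"
      by (simp add: algebra_simps power2_eq_square)
    finally show ?thesis using assms by simp
  qed
  have fin: "(\<integral>t. indicator {0..real n} t *\<^sub>R ?f t \<partial>lborel) = F (real n) - F 0" for n
  proof -
    have "(\<integral>t. indicator {0..real n} t *\<^sub>R ?f t \<partial>lborel)
        = (\<integral>t. indicator {0..real n} t *\<^sub>R (exp (- c * t) * cos (t * x)) \<partial>lborel)"
      by (intro Bochner_Integration.integral_cong) (auto simp: indicator_def)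
    also have "\<dots> = F (real n) - F 0"
      by (rule integral_FTC_atLeastAtMost)
         (use F' in \<open>auto intro!: continuous_intros simp: has_real_derivative_iff_has_vector_derivative[symmetric]\<close>)
    finally show ?thesis .
  qed
  have lim1: "(\<lambda>n. \<integral>t. indicator {0..real n} t *\<^sub>R ?f t \<partial>lborel) \<longlonglongrightarrow> (\<integral>t. indicator {0..} t *\<^sub>R ?f t \<partial>lborel)"
  proof (rule integral_dominated_convergence[where w="\<lambda>t. exp (- c * \<bar>t\<bar>)"])
    show "integrable lborel (\<lambda>t. exp (- c * \<bar>t\<bar>))" by (rule integrable_exp_abs[OF assms])
    show "AE t in lborel. (\<lambda>n. indicator {0..real n} t *\<^sub>R ?f t) \<longlonglongrightarrow> indicator {0..} t *\<^sub>R ?f t"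
    proof (intro always_eventually allI)
      fix t :: real
      have "eventually (\<lambda>n. indicator {0..real n} t *\<^sub>R ?f t = indicator {0..} t *\<^sub>R ?f t) sequentially"
        using eventually_ge_at_top[of "nat \<lceil>t\<rceil>"] by eventually_elim (auto simp: indicator_def)
      then show "(\<lambda>n. indicator {0..real n} t *\<^sub>R ?f t) \<longlonglongrightarrow> indicator {0..} t *\<^sub>R ?f t"
        by (rule tendsto_eventually)
    qed
    show "AE t in lborel. norm (indicator {0..real n} t *\<^sub>R ?f t) \<le> exp (- c * \<bar>t\<bar>)" for n
      by (auto simp: indicator_def abs_mult mult_left_le)
  qed auto
  have "(\<lambda>n. F (real n)) \<longlonglongrightarrow> 0"
  proof (rule Lim_null_comparison)
    show "(\<lambda>n. exp (- c * real n) * ((\<bar>x\<bar> + c) / (c\<^sup>2 + x\<^sup>2))) \<longlonglongrightarrow> 0"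
    proof (rule tendsto_mult_left_zero)
      show "(\<lambda>n. exp (- c * real n)) \<longlonglongrightarrow> 0" using assms by real_asymp
    qed
    have "\<bar>x * sin (t * x) - c * cos (t * x)\<bar> \<le> \<bar>x\<bar> + c" for t
    proof -
      have "\<bar>x * sin (t * x) - c * cos (t * x)\<bar> \<le> \<bar>x * sin (t * x)\<bar> + \<bar>c * cos (t * x)\<bar>"
        by (rule abs_triangle_ineq4)
      also have "\<dots> \<le> \<bar>x\<bar> * 1 + c * 1"
        unfolding abs_mult using assms by (intro add_mono mult_mono) auto
      finally show ?thesis by simp
    qed
    then have "norm (F t) \<le> exp (- c * t) * ((\<bar>x\<bar> + c) / (c\<^sup>2 + x\<^sup>2))" for t
      using pos unfolding F_def by (simp add: abs_mult divide_right_mono mult_left_mono)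
    then show "eventually (\<lambda>n. norm (F (real n)) \<le> exp (- c * real n) * ((\<bar>x\<bar> + c) / (c\<^sup>2 + x\<^sup>2))) sequentially"
      by (intro always_eventually) blast
  qed
  then have "(\<lambda>n. F (real n) - F 0) \<longlonglongrightarrow> 0 - F 0" by (intro tendsto_intros)
  then have half: "(\<integral>t. indicator {0..} t *\<^sub>R ?f t \<partial>lborel) = c / (c\<^sup>2 + x\<^sup>2)"
    using lim1 unfolding fin by (simp add: LIMSEQ_unique F_def)
  have "integrable lborel (\<lambda>t. indicator {0..} t *\<^sub>R ?f t)"
    by (rule Bochner_Integration.integrable_bound[OF integrable_exp_abs[OF assms]])
       (auto simp: indicator_def abs_mult mult_left_le)
  then have "has_bochner_integral lborel (\<lambda>t. indicator {0..} t *\<^sub>R ?f t) (c / (c\<^sup>2 + x\<^sup>2))"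
    using half by (simp add: has_bochner_integral_iff)
  from has_bochner_integral_even_function[OF this] show ?thesis
    by (auto simp: has_bochner_integral_iff)
qed

section \<open>Convergence of the rescaled characteristic function\<close>

context stable_multiplier begin

text \<open>The power in the inversion formula after the substitution
  \<open>\<theta> = t / m\<close>, the scaling at which \<open>\<beta> = 1\<close> has a limit; it
  is cut off outside one period.\<close>

definition rescaled :: "nat \<Rightarrow> real \<Rightarrow> real" where
  "rescaled m t = indicator {-pi..pi} (t / real m) * \<phi> (t / real m) ^ m"

lemma \<phi>_abs: "\<phi> \<bar>\<theta>\<bar> = \<phi> \<theta>"
  by (simp add: abs_if even)

lemma \<phi>_measurable [measurable]: "\<phi> \<in> borel_measurable borel"
  by (intro borel_measurable_continuous_onI continuous_at_imp_continuous_on ballI cont)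

lemma rescaled_measurable [measurable]: "rescaled m \<in> borel_measurable borel"
  unfolding rescaled_def[abs_def] by measurable

text \<open>On one period the modulus of \<open>\<phi> \<theta>\<close> is at most
  \<open>1 - a * \<theta> \<le> exp (- a * \<theta>)\<close> for
  \<open>\<theta> = \<bar>t / m\<bar>\<close>, and the \<open>m\<close>-th power of the exponential
  is free of \<open>m\<close>. This is the dominating function for the limit.\<close>

lemma rescaled_bound:
  assumes "\<beta> = 1"
  obtains a where "0 < a" "\<And>m t. 1 \<le> m \<Longrightarrow> \<bar>rescaled m t\<bar> \<le> exp (- a * \<bar>t\<bar>)"
proof -
  obtain a where a: "0 < a" "\<And>\<theta>. 0 < \<theta> \<Longrightarrow> \<theta> \<le> pi \<Longrightarrow> a * \<theta> powr \<beta> \<le> 1 - \<bar>\<phi> \<theta>\<bar>"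
    using gap by blast
  show ?thesis
  proof (rule that[OF a(1)])
    fix m :: nat and t :: real
    assume m: "1 \<le> m"
    show "\<bar>rescaled m t\<bar> \<le> exp (- a * \<bar>t\<bar>)"
    proof (cases "t / real m \<in> {-pi..pi}")
      case True
      define \<theta> where "\<theta> = \<bar>t / real m\<bar>"
      have \<theta>: "0 \<le> \<theta>" "\<theta> \<le> pi" using True by (auto simp: \<theta>_def abs_le_iff)
      have "\<bar>\<phi> \<theta>\<bar> \<le> 1 - a * \<theta>"
        using a(2)[of \<theta>] \<theta> assms at_0 by (cases "\<theta> = 0") auto
      also have "\<dots> \<le> exp (- (a * \<theta>))"
        using exp_ge_add_one_self[of "- (a * \<theta>)"] by simp
      finally have "\<bar>\<phi> \<theta>\<bar> ^ m \<le> exp (- (a * \<theta>)) ^ m"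
        by (intro power_mono) auto
      also have "\<dots> = exp (- a * \<bar>t\<bar>)"
        using m by (simp add: exp_of_nat_mult[symmetric] \<theta>_def abs_divide)
      also have "\<phi> \<theta> = \<phi> (t / real m)" unfolding \<theta>_def by (rule \<phi>_abs)
      finally show ?thesis
        using True by (simp add: rescaled_def power_abs)
    qed (auto simp: rescaled_def)
  qed
qed

text \<open>For numbers of modulus at most \<open>1\<close>, the \<open>m\<close>-th powers differ
  by at most \<open>m\<close> times the difference of the bases. The bases
  \<open>\<phi> \<theta>\<close> and \<open>exp (- c * \<theta>)\<close> are at distance of order
  \<open>m powr (- 1 - s)\<close>.\<close>

lemma rescaled_limit:
  assumes "\<beta> = 1"
  shows "(\<lambda>m. rescaled m t) \<longlonglongrightarrow> exp (- c * \<bar>t\<bar>)"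
proof (cases "t = 0")
  case True
  then show ?thesis by (simp add: rescaled_def at_0)
next
  case False
  define u where "u = \<bar>t\<bar>"
  have u: "0 < u" using False by (simp add: u_def)
  obtain K \<delta> where K: "0 < K" "0 < \<delta>"
    and expn: "\<And>\<theta>. 0 < \<theta> \<Longrightarrow> \<theta> < \<delta> \<Longrightarrow> \<bar>\<phi> \<theta> - (1 - c * \<theta> powr \<beta>)\<bar> \<le> K * \<theta> powr (\<beta> + s)"
    using near_0 by metis
  have small: "(\<lambda>m. u / real m) \<longlonglongrightarrow> 0" by real_asymp
  have "(\<lambda>m. rescaled m t - exp (- c * u)) \<longlonglongrightarrow> 0"
  proof (rule Lim_null_comparison)
    let ?e = "\<lambda>m. real m * (K * (u / real m) powr (1 + s)) + \<bar>real m * (exp (- c * u / real m) - (1 - c * u / real m))\<bar>"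
    have "(\<lambda>m. real m * (K * (u / real m) powr (1 + s))) \<longlonglongrightarrow> 0"
      using u K s_pos by real_asymp
    moreover have "(\<lambda>m. real m * (exp (- c * u / real m) - (1 - c * u / real m))) \<longlonglongrightarrow> 0"
      using u c_pos by real_asymp
    ultimately show "?e \<longlonglongrightarrow> 0"
      by (intro tendsto_add_zero tendsto_rabs_zero)
    \<comment> \<open>From here on the cutoff in \<open>rescaled\<close> equals \<open>1\<close> and
      the expansion at \<open>0\<close> applies.\<close>
    have "eventually (\<lambda>m. u / real m < min \<delta> pi) sequentially"
      using small K pi_gt_zero by (intro order_tendstoD) auto
    then show "eventually (\<lambda>m. norm (rescaled m t - exp (- c * u)) \<le> ?e m) sequentially"
      using eventually_gt_at_top[of 0]
    proof eventually_elim
      case (elim m)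
      define \<theta> where "\<theta> = u / real m"
      have \<theta>: "0 < \<theta>" "\<theta> < \<delta>" "\<theta> \<le> pi" using elim u by (auto simp: \<theta>_def)
      have abs: "\<bar>t / real m\<bar> = \<theta>" by (simp add: \<theta>_def u_def abs_divide)
      then have "rescaled m t = \<phi> \<theta> ^ m"
        using \<theta> \<phi>_abs[of "t / real m"] by (auto simp: rescaled_def indicator_def abs_if split: if_splits)
      moreover have "exp (- c * u) = exp (- c * \<theta>) ^ m"
        using elim by (simp add: exp_of_nat_mult[symmetric] \<theta>_def)
      ultimately have "norm (rescaled m t - exp (- c * u)) = norm (\<phi> \<theta> ^ m - exp (- c * \<theta>) ^ m)"
        by simp
      also have "\<dots> \<le> real m * norm (\<phi> \<theta> - exp (- c * \<theta>))"
        using abs_le_1 c_pos \<theta> by (intro norm_power_diff) auto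
      also have "\<dots> \<le> real m * (\<bar>\<phi> \<theta> - (1 - c * \<theta>)\<bar> + \<bar>exp (- c * \<theta>) - (1 - c * \<theta>)\<bar>)"
        by (intro mult_left_mono) auto
      also have "\<dots> \<le> real m * (K * \<theta> powr (1 + s) + \<bar>exp (- c * \<theta>) - (1 - c * \<theta>)\<bar>)"
        using expn[of \<theta>] \<theta> assms by (intro mult_left_mono add_mono) auto
      also have "\<dots> = ?e m"
        by (simp add: distrib_left \<theta>_def abs_mult)
      finally show ?case .
    qed
  qed
  then show ?thesis unfolding u_def by (rule LIM_zero_cancel)
qed

text \<open>Dominated convergence gives convergence in mean of \<open>rescaled\<close>, so the
  cosine transform is close to that of the limit uniformly in \<open>x\<close>; the latter is
  bounded below when \<open>\<bar>x\<bar> \<le> m\<close>.\<close>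

lemma local_limit_lower_bound:
  assumes "\<beta> = 1"
  obtains a m0 where "0 < a" "1 \<le> m0"
    "\<And>m x. m0 \<le> m \<Longrightarrow> \<bar>x\<bar> \<le> real m \<Longrightarrow>
      a / real m \<le> (\<integral>\<theta>. indicator {-pi..pi} \<theta> *\<^sub>R (cos (\<theta> * x) * \<phi> \<theta> ^ m) \<partial>lborel)"
proof -
  obtain a where a: "0 < a" "\<And>m t. 1 \<le> m \<Longrightarrow> \<bar>rescaled m t\<bar> \<le> exp (- a * \<bar>t\<bar>)"
    using rescaled_bound[OF assms] by blast
  let ?E = "\<lambda>t. exp (- c * \<bar>t\<bar>)"
  have intE: "integrable lborel ?E" by (rule integrable_exp_abs[OF c_pos])
  have intR: "integrable lborel (rescaled m)" if "1 \<le> m" for m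
    by (rule Bochner_Integration.integrable_bound[OF integrable_exp_abs[OF a(1)]])
       (use a(2)[OF that] in auto)
  \<comment> \<open>This distance is free of \<open>x\<close>, so the threshold \<open>m0\<close>
    below works for all targets at once.\<close>
  define \<eta> where "\<eta> m = (\<integral>t. \<bar>rescaled m t - ?E t\<bar> \<partial>lborel)" for m
  have "(\<lambda>m. \<eta> (Suc m)) \<longlonglongrightarrow> (\<integral>t. 0 \<partial>(lborel :: real measure))"
    unfolding \<eta>_def
  proof (rule integral_dominated_convergence[where w="\<lambda>t. exp (- a * \<bar>t\<bar>) + ?E t"])
    show "integrable lborel (\<lambda>t. exp (- a * \<bar>t\<bar>) + ?E t)"
      by (intro Bochner_Integration.integrable_add integrable_exp_abs a(1) c_pos)
    show "AE t in lborel. (\<lambda>m. \<bar>rescaled (Suc m) t - ?E t\<bar>) \<longlonglongrightarrow> 0"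
      by (intro always_eventually allI tendsto_rabs_zero LIM_zero
            filterlim_compose[OF rescaled_limit[OF assms] filterlim_Suc])
    show "AE t in lborel. norm \<bar>rescaled (Suc m) t - ?E t\<bar> \<le> exp (- a * \<bar>t\<bar>) + ?E t" for m
    proof (intro always_eventually allI)
      fix t
      show "norm \<bar>rescaled (Suc m) t - ?E t\<bar> \<le> exp (- a * \<bar>t\<bar>) + ?E t"
        using a(2)[of "Suc m" t] abs_triangle_ineq4[of "rescaled (Suc m) t" "?E t"] by simp
    qed
  qed auto
  then have "\<eta> \<longlonglongrightarrow> 0" by (simp add: filterlim_sequentially_Suc)
  \<comment> \<open>The threshold is half of \<open>2 * c / (c^2 + 1)\<close>, the least value of
    the limit transform at rescaled targets of modulus at most \<open>1\<close>.\<close>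
  then have "eventually (\<lambda>m. \<eta> m < c / (c\<^sup>2 + 1)) sequentially"
    using c_pos by (intro order_tendstoD) (auto simp: add_nonneg_pos)
  then obtain m0 where m0: "\<And>m. m0 \<le> m \<Longrightarrow> \<eta> m < c / (c\<^sup>2 + 1)"
    unfolding eventually_sequentially by blast
  show ?thesis
  proof (rule that[of "c / (c\<^sup>2 + 1)" "max 1 m0"])
    show "0 < c / (c\<^sup>2 + 1)" using c_pos by (auto simp: add_nonneg_pos)
    fix m :: nat and x :: real
    assume m: "max 1 m0 \<le> m" and x: "\<bar>x\<bar> \<le> real m"
    define x' where "x' = x / real m"
    have "\<bar>x'\<bar> \<le> 1" using x m by (simp add: x'_def abs_divide)
    then have x': "x'\<^sup>2 \<le> 1" by (simp add: abs_square_le_1)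
    have intc: "integrable lborel (\<lambda>t. f t * cos (t * x'))"
      if "integrable lborel f" for f :: "real \<Rightarrow> real"
      by (rule Bochner_Integration.integrable_bound[OF that])
         (use that in \<open>auto simp: abs_mult mult_left_le\<close>)
    have "(\<integral>\<theta>. indicator {-pi..pi} \<theta> *\<^sub>R (cos (\<theta> * x) * \<phi> \<theta> ^ m) \<partial>lborel)
        = \<bar>1 / real m\<bar> *\<^sub>R (\<integral>t. indicator {-pi..pi} (0 + 1 / real m * t) *\<^sub>R
            (cos ((0 + 1 / real m * t) * x) * \<phi> (0 + 1 / real m * t) ^ m) \<partial>lborel)"
      by (rule lborel_integral_real_affine) (use m in auto)
    also have "\<dots> = (\<integral>t. rescaled m t * cos (t * x') \<partial>lborel) / real m"
      by (simp add: rescaled_def x'_def mult_ac)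
    finally have eq: "(\<integral>\<theta>. indicator {-pi..pi} \<theta> *\<^sub>R (cos (\<theta> * x) * \<phi> \<theta> ^ m) \<partial>lborel)
        = (\<integral>t. rescaled m t * cos (t * x') \<partial>lborel) / real m" .
    have "\<bar>(\<integral>t. rescaled m t * cos (t * x') \<partial>lborel) - (\<integral>t. ?E t * cos (t * x') \<partial>lborel)\<bar>
        = \<bar>\<integral>t. (rescaled m t - ?E t) * cos (t * x') \<partial>lborel\<bar>"
      using m intc[OF intR] intc[OF intE] by (simp add: left_diff_distrib)
    also have "\<dots> \<le> (\<integral>t. \<bar>(rescaled m t - ?E t) * cos (t * x')\<bar> \<partial>lborel)"
      by (rule integral_abs_bound)
    also have "\<dots> \<le> \<eta> m"
      unfolding \<eta>_def using m intR intE
      by (intro integral_mono integrable_abs intc Bochner_Integration.integrable_diff)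
         (auto simp: abs_mult mult_left_le)
    also have "\<dots> < c / (c\<^sup>2 + 1)" using m0 m by simp
    finally have "2 * c / (c\<^sup>2 + x'\<^sup>2) - c / (c\<^sup>2 + 1) \<le> (\<integral>t. rescaled m t * cos (t * x') \<partial>lborel)"
      unfolding integral_exp_abs_cos[OF c_pos] by linarith
    moreover have "2 * c / (c\<^sup>2 + 1) \<le> 2 * c / (c\<^sup>2 + x'\<^sup>2)"
      using x' c_pos by (intro divide_left_mono add_left_mono mult_pos_pos add_pos_nonneg) auto
    ultimately have "c / (c\<^sup>2 + 1) \<le> (\<integral>t. rescaled m t * cos (t * x') \<partial>lborel)"
      by (simp only: times_divide_eq_right[symmetric])
    then show "c / (c\<^sup>2 + 1) / real m \<le> (\<integral>\<theta>. indicator {-pi..pi} \<theta> *\<^sub>R (cos (\<theta> * x) * \<phi> \<theta> ^ m) \<partial>lborel)"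
      unfolding eq by (rule divide_right_mono) simp
  qed simp
qed

end

section \<open>Bounds for the catching probability\<close>

text \<open>The path is frozen at time \<open>N\<close>, so every further step, before or after
  \<open>N\<close>, moves it by at most \<open>1\<close>.\<close>

lemma lipschitz_path:
  fixes y :: "nat \<Rightarrow> int"
  assumes "\<And>n. n \<in> {1..<N} \<Longrightarrow> \<bar>y n - y (n + 1)\<bar> \<le> 1" and "1 \<le> a"
  shows "\<bar>y (min (a + j) N) - y (min a N)\<bar> \<le> int j"
proof (induction j)
  case (Suc j)
  have "\<bar>y (min (a + Suc j) N) - y (min (a + j) N)\<bar> \<le> 1"
  proof (cases "a + j < N")
    case True
    then show ?thesis using assms(1)[of "a + j"] assms(2) by (simp add: abs_minus_commute)
  qed simp
  with Suc show ?case unfolding of_nat_Suc by linarith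
qed simp

context iid_int_walk begin

text \<open>By symmetry the value at \<open>- \<theta>\<close> equals the value at
  \<open>\<theta>\<close>; it is also its conjugate.\<close>

lemma step_char_real:
  assumes "symmetric_law M X"
  shows "Im (step_char \<theta>) = 0"
proof -
  have "step_char (- \<theta>) = step_char \<theta>"
    unfolding step_char_eq_step_charfun step_charfun_def
    using assms by (intro infsum_reindex_bij_witness[where i=uminus and j=uminus]) (auto simp: symmetric_law_def)
  then show ?thesis unfolding step_char_minus by (simp add: complex_eq_iff)
qed

lemma stable_multiplier_step_char:
  assumes A1: "strongly_aperiodic M X" and A2: "symmetric_law M X"
    and pos: "0 < \<beta>" "0 < cstar" "0 < \<epsilon>"
    and A3: "stable_expansion M X \<beta> cstar \<epsilon>"
  shows "stable_multiplier (\<lambda>\<theta>. Re (step_char \<theta>)) \<beta> cstar (min \<epsilon> 1)"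
proof
  interpret D: real_distribution "distr M borel (\<lambda>\<omega>. real_of_int (X 1 \<omega>))"
    by (rule real_distribution_step)
  have Re: "cmod (step_char \<theta>) = \<bar>Re (step_char \<theta>)\<bar>" for \<theta>
    using step_char_real[OF A2] by (simp add: cmod_eq_Re)
  show "isCont (\<lambda>\<theta>. Re (step_char \<theta>)) \<theta>" for \<theta>
    unfolding step_char_def by (intro isCont_Re D.isCont_char)
  show "Re (step_char 0) = 1" unfolding step_char_def D.char_zero by simp
  show "Re (step_char (- \<theta>)) = Re (step_char \<theta>)" for \<theta> by (simp add: step_char_minus)
  show "Re (step_char (\<theta> + 2 * pi)) = Re (step_char \<theta>)" for \<theta> by (simp add: step_char_periodic)
  show "\<bar>Re (step_char \<theta>)\<bar> \<le> 1" for \<theta>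
    unfolding Re[symmetric] unfolding step_char_def by (rule D.cmod_char_le_1)
  show "\<bar>Re (step_char \<theta>)\<bar> < 1" if "0 < \<theta>" "\<theta> \<le> pi" for \<theta>
    unfolding Re[symmetric] using that step_char_real[OF A2] pi_gt_zero
    by (intro cmod_step_char_less_1[OF A1]) linarith+
  obtain K where "0 < K" and K: "eventually (\<lambda>\<theta>. norm (step_charfun M X \<theta> - complex_of_real (1 - cstar * \<bar>\<theta>\<bar> powr \<beta>))
       \<le> K * norm (complex_of_real (\<bar>\<theta>\<bar> powr (\<beta> + \<epsilon>)))) (at 0)"
    using A3 unfolding stable_expansion_def by (rule landau_o.bigE)
  \<comment> \<open>For \<open>\<bar>\<theta>\<bar> \<le> 1\<close>, lowering the exponent from
    \<open>\<epsilon>\<close> to \<open>min \<epsilon> 1\<close> only enlarges the error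
    bound.\<close>
  have near: "eventually (\<lambda>\<theta>::real. \<bar>\<theta>\<bar> \<le> 1) (at 0)"
    unfolding eventually_at by (intro exI[of _ 1]) auto
  show "\<exists>K. eventually (\<lambda>\<theta>. \<bar>Re (step_char \<theta>) - (1 - cstar * \<bar>\<theta>\<bar> powr \<beta>)\<bar>
      \<le> K * \<bar>\<theta>\<bar> powr (\<beta> + min \<epsilon> 1)) (at 0)"
  proof (intro exI[of _ K])
    from K near show "eventually (\<lambda>\<theta>. \<bar>Re (step_char \<theta>) - (1 - cstar * \<bar>\<theta>\<bar> powr \<beta>)\<bar>
      \<le> K * \<bar>\<theta>\<bar> powr (\<beta> + min \<epsilon> 1)) (at 0)"
    proof eventually_elim
      case (elim \<theta>)
      have "\<bar>Re (step_char \<theta>) - (1 - cstar * \<bar>\<theta>\<bar> powr \<beta>)\<bar>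
          = \<bar>Re (step_charfun M X \<theta> - complex_of_real (1 - cstar * \<bar>\<theta>\<bar> powr \<beta>))\<bar>"
        by (simp add: step_char_eq_step_charfun)
      also have "\<dots> \<le> cmod (step_charfun M X \<theta> - complex_of_real (1 - cstar * \<bar>\<theta>\<bar> powr \<beta>))"
        by (rule abs_Re_le_cmod)
      also have "\<dots> \<le> K * \<bar>\<theta>\<bar> powr (\<beta> + \<epsilon>)"
        using elim(1) by (simp only: norm_of_real abs_of_nonneg powr_ge_zero)
      also have "\<dots> \<le> K * \<bar>\<theta>\<bar> powr (\<beta> + min \<epsilon> 1)"
        using elim(2) \<open>0 < K\<close> by (intro mult_left_mono powr_mono') auto
      finally show ?case .
    qed
  qed
qed (use pos in auto)

lemma catch_prob_ge_inverse_green_bound: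
  assumes "1 \<le> N" and G: "green_bound (\<lambda>\<theta>. cmod (step_char \<theta>)) N \<le> G" "0 < G"
  shows "1 / G \<le> catch_prob M X N y"
proof -
  have "1 \<le> G * catch_prob M X N y"
  proof (rule catch_prob_lower[OF assms(1)])
    fix n assume n: "n \<in> {1..N}"
    have "(\<Sum>j\<le>N - n. return_prob N j (y (n + j) - y n))
        \<le> (\<Sum>j\<le>N - n. (\<Sum>k<N. cmod (step_char (2 * pi * real k / real N)) ^ j) / real N)"
      by (intro sum_mono return_prob_le assms(1))
    \<comment> \<open>Since \<open>n \<ge> 1\<close>, all times up to \<open>N - n\<close> are below
      \<open>N\<close>, and the added terms are nonnegative.\<close>
    also have "\<dots> \<le> (\<Sum>j<N. (\<Sum>k<N. cmod (step_char (2 * pi * real k / real N)) ^ j) / real N)"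
      using n by (intro sum_mono2) (auto intro!: divide_nonneg_nonneg sum_nonneg)
    also have "\<dots> = green_bound (\<lambda>\<theta>. cmod (step_char \<theta>)) N"
      unfolding green_bound_def sum_divide_distrib[symmetric] by (subst sum.swap) simp
    finally show "(\<Sum>j\<le>N - n. return_prob N j (y (n + j) - y n)) \<le> G" using G by simp
  qed
  then show ?thesis using G by (simp add: divide_le_eq mult.commute)
qed

end

section \<open>The three ranges of the exponent\<close>

locale stable_walk = iid_int_walk M X + stable_multiplier "\<lambda>\<theta>. Re (step_char \<theta>)" \<beta> c s
  for M :: "'a measure" and X :: "nat \<Rightarrow> 'a \<Rightarrow> int" and \<beta> c s :: real +
  assumes Im_0: "Im (step_char \<theta>) = 0"
begin

lemma cmod_eq: "cmod (step_char \<theta>) = \<bar>Re (step_char \<theta>)\<bar>"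
  using Im_0 by (simp add: cmod_eq_Re)

lemma catch_prob_ge_beta_less_1:
  assumes "\<beta> < 1"
  shows "\<exists>c1>0. \<forall>N\<ge>1. \<forall>y. c1 \<le> catch_prob M X N y"
proof -
  obtain C where C: "0 < C"
    "\<And>\<theta>. 0 < \<theta> \<Longrightarrow> \<theta> \<le> pi \<Longrightarrow> 1 / (1 - \<bar>Re (step_char \<theta>)\<bar>) \<le> C * \<theta> powr (- \<beta>)"
    using inverse_gap by blast
  define G where "G = 1 + 2 * C * (2 * pi) powr (- \<beta>) / (1 - \<beta>)"
  have G: "0 < G"
    using C assms by (auto simp: G_def intro!: add_pos_nonneg divide_nonneg_nonneg)
  have "1 / G \<le> catch_prob M X N y" if N: "1 \<le> N" for N y
  proof (rule catch_prob_ge_inverse_green_bound[OF N _ G])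
    \<comment> \<open>\<open>a = 0\<close> removes the logarithm, and \<open>s = 1 - \<beta>\<close>
      matches the power in the inverse gap.\<close>
    have "green_bound (\<lambda>\<theta>. cmod (step_char \<theta>)) N
        \<le> 1 + 0 / pi * (ln (real N) + 1) + 2 * C * (2 * pi) powr (1 - \<beta> - 1) / (1 - \<beta>)"
      unfolding cmod_eq by (rule green_bound_le_log) (use N assms \<beta>_pos C in auto)
    then show "green_bound (\<lambda>\<theta>. cmod (step_char \<theta>)) N \<le> G" by (simp add: G_def)
  qed
  then show ?thesis using G by (intro exI[of _ "1 / G"]) auto
qed

lemma catch_prob_ge_beta_eq_1:
  assumes "\<beta> = 1"
  shows "\<exists>c2>0. \<forall>N\<ge>1. \<forall>y. 1 / (ln (real N) / (c * pi) + c2) \<le> catch_prob M X N y"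
proof -
  obtain C where C: "0 < C"
    "\<And>\<theta>. 0 < \<theta> \<Longrightarrow> \<theta> \<le> pi \<Longrightarrow> 1 / (1 - \<bar>Re (step_char \<theta>)\<bar>) \<le> 1 / c / \<theta> + C * \<theta> powr (s - 1)"
    using inverse_gap_sharp[OF assms] by blast
  define c2 where "c2 = 1 + 1 / (c * pi) + 2 * C * (2 * pi) powr (s - 1) / s"
  have c2: "0 < c2"
    using C s_pos c_pos by (auto simp: c2_def intro!: add_pos_nonneg divide_nonneg_nonneg)
  have "1 / (ln (real N) / (c * pi) + c2) \<le> catch_prob M X N y" if N: "1 \<le> N" for N y
  proof (rule catch_prob_ge_inverse_green_bound[OF N])
    have "green_bound (\<lambda>\<theta>. cmod (step_char \<theta>)) N
        \<le> 1 + 1 / c / pi * (ln (real N) + 1) + 2 * C * (2 * pi) powr (s - 1) / s"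
      unfolding cmod_eq by (rule green_bound_le_log) (use N s_pos s_le_1 c_pos C in auto)
    also have "\<dots> = ln (real N) / (c * pi) + c2"
      by (simp add: c2_def distrib_left)
    finally show "green_bound (\<lambda>\<theta>. cmod (step_char \<theta>)) N \<le> ln (real N) / (c * pi) + c2" .
    show "0 < ln (real N) / (c * pi) + c2"
      using N c2 c_pos by (intro add_nonneg_pos) auto
  qed
  then show ?thesis using c2 by blast
qed

lemma catch_prob_ge_beta_greater_1:
  assumes "1 < \<beta>"
  shows "\<exists>c4>0. \<forall>N\<ge>1. \<forall>y. c4 / real N powr ((\<beta> - 1) / \<beta>) \<le> catch_prob M X N y"
proof -
  obtain C where C: "0 < C"
    "\<And>\<theta>. 0 < \<theta> \<Longrightarrow> \<theta> \<le> pi \<Longrightarrow> 1 / (1 - \<bar>Re (step_char \<theta>)\<bar>) \<le> C * \<theta> powr (- \<beta>)"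
    using inverse_gap by blast
  define K where "K = 3 + 2 * C * (2 * pi) powr (- \<beta>) * 2 powr (\<beta> - 1) / (\<beta> - 1)"
  have K: "0 < K"
    using C assms by (auto simp: K_def intro!: add_pos_nonneg divide_nonneg_nonneg)
  have "1 / K / real N powr ((\<beta> - 1) / \<beta>) \<le> catch_prob M X N y" if N: "1 \<le> N" for N y
  proof -
    have "green_bound (\<lambda>\<theta>. cmod (step_char \<theta>)) N \<le> K * real N powr ((\<beta> - 1) / \<beta>)"
      unfolding cmod_eq K_def by (rule green_bound_le_powr) (use N assms C in auto)
    from catch_prob_ge_inverse_green_bound[OF N this] show ?thesis using K N by simp
  qed
  then show ?thesis using K by (intro exI[of _ "1 / K"]) auto
qed

lemma prob_walk_lower_bound:
  assumes "\<beta> = 1"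
  obtains a m0 where "0 < a" "1 \<le> m0"
    "\<And>m z. m0 \<le> m \<Longrightarrow> \<bar>z\<bar> \<le> int m \<Longrightarrow> a / real m \<le> prob {\<omega> \<in> space M. walk X m \<omega> = z}"
proof -
  obtain a m0 where a: "0 < a" "1 \<le> m0"
    "\<And>m x. m0 \<le> m \<Longrightarrow> \<bar>x\<bar> \<le> real m \<Longrightarrow>
      a / real m \<le> (\<integral>\<theta>. indicator {-pi..pi} \<theta> *\<^sub>R (cos (\<theta> * x) * Re (step_char \<theta>) ^ m) \<partial>lborel)"
    using local_limit_lower_bound[OF assms] by blast
  show ?thesis
  proof (rule that[of "a / (2 * pi)" m0])
    fix m :: nat and z :: int
    assume m: "m0 \<le> m" "\<bar>z\<bar> \<le> int m"
    have real: "step_char \<theta> = complex_of_real (Re (step_char \<theta>))" for \<theta>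
      using Im_0 by (simp add: complex_eq_iff)
    have "Re (cis (- \<theta> * of_int z) * step_char \<theta> ^ m) = cos (\<theta> * of_int z) * Re (step_char \<theta>) ^ m" for \<theta>
      by (subst real, subst of_real_power[symmetric]) simp
    then have "2 * pi * prob {\<omega> \<in> space M. walk X m \<omega> = z}
        = (\<integral>\<theta>. indicator {-pi..pi} \<theta> *\<^sub>R (cos (\<theta> * of_int z) * Re (step_char \<theta>) ^ m) \<partial>lborel)"
      unfolding prob_walk_eq_integral by simp
    moreover have "\<bar>real_of_int z\<bar> \<le> real m" using m(2) by linarith
    ultimately have "a / real m \<le> 2 * pi * prob {\<omega> \<in> space M. walk X m \<omega> = z}"
      using a(3)[OF m(1)] by simp
    then have "a / real m / (2 * pi) \<le> 2 * pi * prob {\<omega> \<in> space M. walk X m \<omega> = z} / (2 * pi)"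
      by (rule divide_right_mono) simp
    then show "a / (2 * pi) / real m \<le> prob {\<omega> \<in> space M. walk X m \<omega> = z}"
      by (simp add: mult_ac)
  qed (use a in auto)
qed

lemma catch_prob_le_beta_eq_1:
  assumes "\<beta> = 1"
  shows "\<exists>c3>0. \<forall>N\<ge>2. \<forall>y. (\<forall>n\<in>{1..<N}. \<bar>y n - y (n + 1)\<bar> \<le> 1) \<longrightarrow> catch_prob M X N y \<le> c3 / ln (real N)"
proof -
  obtain a m0 where a: "0 < a" "1 \<le> m0"
    "\<And>m z. m0 \<le> m \<Longrightarrow> \<bar>z\<bar> \<le> int m \<Longrightarrow> a / real m \<le> prob {\<omega> \<in> space M. walk X m \<omega> = z}"
    using prob_walk_lower_bound[OF assms] by blast
  \<comment> \<open>Pays for the first \<open>m0\<close> times, where the local bound is given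
    up.\<close>
  define b where "b = a * harm m0"
  have b: "0 \<le> b" using a by (simp add: b_def harm_nonneg)
  have green: "1 + (a * ln (real N) - b) \<le> (\<Sum>j\<le>N. return_prob N j (z j))" "1 \<le> (\<Sum>j\<le>N. return_prob N j (z j))"
    if z: "\<And>j. \<bar>z j\<bar> \<le> int j" and N: "1 \<le> N" for N z
  proof -
    have "z 0 = 0" using z[of 0] by simp
    then have r0: "return_prob N 0 (z 0) = 1"
      by (simp add: return_prob_def walk_def prob_space)
    have split: "(\<Sum>j\<le>N. return_prob N j (z j)) = 1 + (\<Sum>j=1..N. return_prob N j (z j))"
      by (simp add: atMost_atLeast0 sum.atLeast_Suc_atMost r0)
    have nonneg: "0 \<le> return_prob N j d" for j d by (simp add: return_prob_def)
    then show "1 \<le> (\<Sum>j\<le>N. return_prob N j (z j))"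
      unfolding split by (simp add: sum_nonneg)
    \<comment> \<open>For \<open>j \<le> m0\<close> the left side is \<open>0\<close>; later the
      displacement bound \<open>\<bar>z j\<bar> \<le> j\<close> puts the target in the range of the
      local bound.\<close>
    have term_le: "a / real j - (if j \<le> m0 then a / real j else 0) \<le> return_prob N j (z j)" for j
      using a(3)[of j "z j"] z[of j] return_prob_ge[of j "z j" N] nonneg[of j "z j"]
      by (cases "j \<le> m0") auto
    have "a * ln (real N) - b \<le> a * harm N - a * harm m0"
    proof -
      have "ln (real N) \<le> ln (real N + 1)" using N by simp
      also have "\<dots> \<le> harm N" by (rule ln_le_harm)
      finally show ?thesis using a(1) by (simp add: b_def)
    qed
    also have "\<dots> \<le> (\<Sum>j=1..N. a / real j) - (\<Sum>j\<in>{j\<in>{1..N}. j \<le> m0}. a / real j)"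
    proof (rule diff_mono)
      show "a * harm N \<le> (\<Sum>j=1..N. a / real j)"
        by (simp add: harm_def sum_distrib_left divide_inverse)
      have "(\<Sum>j\<in>{j\<in>{1..N}. j \<le> m0}. a / real j) \<le> (\<Sum>j=1..m0. a / real j)"
        using a(1) by (intro sum_mono2) auto
      then show "(\<Sum>j\<in>{j\<in>{1..N}. j \<le> m0}. a / real j) \<le> a * harm m0"
        by (simp add: harm_def sum_distrib_left divide_inverse)
    qed
    also have "\<dots> = (\<Sum>j=1..N. a / real j - (if j \<le> m0 then a / real j else 0))"
      by (simp only: sum_subtractf sum.inter_filter finite_atLeastAtMost)
    also have "\<dots> \<le> (\<Sum>j=1..N. return_prob N j (z j))"
      by (intro sum_mono term_le)
    finally show "1 + (a * ln (real N) - b) \<le> (\<Sum>j\<le>N. return_prob N j (z j))"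
      unfolding split by simp
  qed
  define c3 where "c3 = 2 * (1 + b) / a"
  have c3: "0 < c3" using a b by (simp add: c3_def)
  have "catch_prob M X N y \<le> c3 / ln (real N)"
    if N: "2 \<le> N" and y: "\<forall>n\<in>{1..<N}. \<bar>y n - y (n + 1)\<bar> \<le> 1" for N y
  proof -
    \<comment> \<open>Freezing the path at time \<open>N\<close> lets every first hit before \<open>N\<close> be followed for \<open>N\<close> more steps.\<close>
    define y' where "y' n = y (min n N)" for n
    \<comment> \<open>The maximum keeps \<open>g \<ge> 1\<close> for small \<open>N\<close>, where
      the logarithmic bound may be negative.\<close>
    define g where "g = max 1 (1 + (a * ln (real N) - b))"
    have "g * catch_prob M X N y' \<le> 2"
    proof (rule catch_prob_upper)
      fix n assume n: "n \<in> {1..N}"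
      have "\<bar>y' (n + j) - y' n\<bar> \<le> int j" for j
        unfolding y'_def using y n by (intro lipschitz_path) auto
      then have "g \<le> (\<Sum>j\<le>N. return_prob N j (y' (n + j) - y' n))"
        unfolding g_def using N by (intro max.boundedI green) auto
      also have "\<dots> \<le> (\<Sum>j\<le>2 * N - n. return_prob N j (y' (n + j) - y' n))"
        using n by (intro sum_mono2) (auto simp: return_prob_def)
      finally show "g \<le> (\<Sum>j\<le>2 * N - n. return_prob N j (y' (n + j) - y' n))" .
    qed (use N in simp)
    also have "catch_prob M X N y' = catch_prob M X N y"
      by (rule catch_prob_cong) (simp add: y'_def)
    finally have g: "g * catch_prob M X N y \<le> 2" .
    have p: "0 \<le> catch_prob M X N y" by (simp add: catch_prob_def)
    \<comment> \<open>Since \<open>g \<ge> 1\<close>, the deficit \<open>b\<close> is absorbed into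
      \<open>b * g\<close>; this yields \<open>c3 = 2 * (1 + b) / a\<close>.\<close>
    have "a * ln (real N) \<le> g + b * 1" by (simp add: g_def)
    also have "\<dots> \<le> g + b * g" using b by (intro add_left_mono mult_left_mono) (auto simp: g_def)
    finally have "a * ln (real N) * catch_prob M X N y \<le> (1 + b) * g * catch_prob M X N y"
      using p by (intro mult_right_mono) (auto simp: algebra_simps)
    also have "\<dots> \<le> (1 + b) * 2"
      unfolding mult.assoc using g b by (intro mult_left_mono) auto
    finally have "ln (real N) * catch_prob M X N y \<le> c3"
      using a(1) by (simp add: c3_def field_simps)
    then show ?thesis using N by (simp add: field_simps)
  qed
  then show ?thesis using c3 by blast
qed

end

theorem theorem1:
  fixes M :: "'a measure" and X :: "nat \<Rightarrow> 'a \<Rightarrow> int"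
    and \<beta> cstar \<epsilon> :: real
  assumes "prob_space M"
    and "\<And>i. i \<ge> 1 \<Longrightarrow> X i \<in> measurable M (count_space UNIV)"
    and "prob_space.indep_vars M (\<lambda>_. count_space UNIV) X {1..}"
    and "\<And>i. i \<ge> 1 \<Longrightarrow> distr M (count_space UNIV) (X i) = distr M (count_space UNIV) (X 1)"
    and A1: "strongly_aperiodic M X"
    and A2: "symmetric_law M X"
    and "0 < \<beta>" "\<beta> \<le> 2" "0 < cstar" "0 < \<epsilon>"
    and A3: "stable_expansion M X \<beta> cstar \<epsilon>"
  shows
    "(\<beta> < 1 \<longrightarrow>
       (\<exists>c1>0. \<forall>N::nat. \<forall>y::nat \<Rightarrow> int. N \<ge> 2 \<longrightarrow>
          (\<forall>n\<in>{1..<N}. \<bar>y n - y (n + 1)\<bar> \<le> 1) \<longrightarrow>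
          c1 \<le> catch_prob M X N y))
   \<and> (\<beta> = 1 \<longrightarrow>
       (\<exists>c2>0. \<exists>c3>0. \<forall>N::nat. \<forall>y::nat \<Rightarrow> int. N \<ge> 2 \<longrightarrow>
          (\<forall>n\<in>{1..<N}. \<bar>y n - y (n + 1)\<bar> \<le> 1) \<longrightarrow>
          1 / (ln (real N) / (cstar * pi) + c2) \<le> catch_prob M X N y
          \<and> catch_prob M X N y \<le> c3 / ln (real N)))
   \<and> (1 < \<beta> \<longrightarrow>
       (\<exists>c4>0. \<forall>N::nat. \<forall>y::nat \<Rightarrow> int. N \<ge> 2 \<longrightarrow>
          (\<forall>n\<in>{1..<N}. \<bar>y n - y (n + 1)\<bar> \<le> 1) \<longrightarrow>
          c4 / real N powr ((\<beta> - 1) / \<beta>) \<le> catch_prob M X N y))"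
proof -
  interpret iid_int_walk M X
    by (intro iid_int_walk.intro iid_int_walk_axioms.intro assms)
  interpret stable_walk M X \<beta> cstar "min \<epsilon> 1"
    by (intro stable_walk.intro stable_walk_axioms.intro iid_int_walk_axioms
        stable_multiplier_step_char step_char_real assms)
  have two: "1 \<le> N" if "2 \<le> N" for N :: nat using that by simp
  show ?thesis
  proof (intro conjI impI)
    assume "\<beta> < 1"
    then obtain c1 where "0 < c1" "\<forall>N\<ge>1. \<forall>y. c1 \<le> catch_prob M X N y"
      using catch_prob_ge_beta_less_1 by blast
    with two show "\<exists>c1>0. \<forall>N::nat. \<forall>y::nat \<Rightarrow> int. N \<ge> 2 \<longrightarrow>
          (\<forall>n\<in>{1..<N}. \<bar>y n - y (n + 1)\<bar> \<le> 1) \<longrightarrow> c1 \<le> catch_prob M X N y"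
      by blast
  next
    assume \<beta>: "\<beta> = 1"
    obtain c2 where "0 < c2" "\<forall>N\<ge>1. \<forall>y. 1 / (ln (real N) / (cstar * pi) + c2) \<le> catch_prob M X N y"
      using catch_prob_ge_beta_eq_1[OF \<beta>] by blast
    moreover obtain c3 where "0 < c3" "\<forall>N\<ge>2. \<forall>y. (\<forall>n\<in>{1..<N}. \<bar>y n - y (n + 1)\<bar> \<le> 1) \<longrightarrow>
        catch_prob M X N y \<le> c3 / ln (real N)"
      using catch_prob_le_beta_eq_1[OF \<beta>] by blast
    ultimately show "\<exists>c2>0. \<exists>c3>0. \<forall>N::nat. \<forall>y::nat \<Rightarrow> int. N \<ge> 2 \<longrightarrow>
          (\<forall>n\<in>{1..<N}. \<bar>y n - y (n + 1)\<bar> \<le> 1) \<longrightarrow>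
          1 / (ln (real N) / (cstar * pi) + c2) \<le> catch_prob M X N y
          \<and> catch_prob M X N y \<le> c3 / ln (real N)"
      using two by blast
  next
    assume "1 < \<beta>"
    then obtain c4 where "0 < c4" "\<forall>N\<ge>1. \<forall>y. c4 / real N powr ((\<beta> - 1) / \<beta>) \<le> catch_prob M X N y"
      using catch_prob_ge_beta_greater_1 by blast
    with two show "\<exists>c4>0. \<forall>N::nat. \<forall>y::nat \<Rightarrow> int. N \<ge> 2 \<longrightarrow>
          (\<forall>n\<in>{1..<N}. \<bar>y n - y (n + 1)\<bar> \<le> 1) \<longrightarrow>
          c4 / real N powr ((\<beta> - 1) / \<beta>) \<le> catch_prob M X N y"
      by blast
  qed
qed

end
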